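(* Let $s\ge 0$, $n\ge 1$ be integers, let $a_1\ge\cdots\ge a_n>0$ be real numbers, and let $G=\mathbb{R}\ltimes_{\varphi}\mathbb{R}^{s+2n}$ be the flat almost abelian Lie group with $$\varphi(t)=\begin{pmatrix}\mathrm{Id}_{s\times s}&0\\0&\tilde\varphi(t)\end{pmatrix},\qquad \tilde\varphi(t)=\begin{pmatrix}\theta(a_1t)&&\\&\ddots&\\&&\theta(a_nt)\end{pmatrix},\qquad \theta(t)=\begin{pmatrix}\cos t&\sin t\\-\sin t&\cos t\end{pmatrix}.$$ Let $t_0\ne 0$ be such that $\varphi(t_0)$ is conjugate to an integer matrix through a matrix $P\in \mathsf{GL}(s+2n,\mathbb{R})$ (i.e. $P^{-1}\varphi(t_0)P$ is an integer matrix). Let $\Gamma$ be the lattice $\Gamma=t_0\mathbb{Z}\ltimes_{\varphi}P\mathbb{Z}^{s+2n}$ of $G$ and let $$d=\operatorname{lcm}\big(\operatorname{ord}(\theta(a_1t_0)),\dots,\operatorname{ord}(\theta(a_nt_0))\big).$$ Then $$\operatorname{Hol}(\Gamma\backslash G)\cong\begin{cases}\mathbb{Z}_d&\text{if } d>1,\\ \{e\}&\text{if } d=1.\end{cases}$$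
   Context: The product on $\mathbb{R}\ltimes_\varphi\mathbb{R}^m$ is $(t,v)(t',v')=(t+t',v+\varphi(t)v')$. A lattice is a discrete co-compact subgroup. $G$ is equipped with a flat left invariant Riemannian metric, $\Gamma\backslash G$ carries the induced flat Riemannian metric, and $\operatorname{Hol}(\Gamma\backslash G)$ is its Riemannian holonomy group. $\operatorname{ord}$ denotes the order of a matrix in the general linear group, and $\mathbb{Z}_d=\mathbb{Z}/d\mathbb{Z}$. *)

theory Defs
  imports
    "HOL-Analysis.Analysis"
    "HOL-Algebra.Elementary_Groups"
    "HOL-Algebra.Multiplicative_Group"
    "HOL-Algebra.Bij"
begin

section \<open>Riemannian geometry on a vector space\<close>

text \<open>
  The manifold is a Euclidean space \<^typ>\<open>'a\<close> (a single global chart), so that every tangent space is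
  identified with \<^typ>\<open>'a\<close>. Nothing refers to the inner product of \<^typ>\<open>'a\<close>: the metric is the
  field \<open>g\<close> of bilinear forms.
\<close>

primrec C_fun :: "nat \<Rightarrow> ('a::real_normed_vector \<Rightarrow> real) \<Rightarrow> bool" where
  "C_fun 0 f \<longleftrightarrow> continuous_on UNIV f"
| "C_fun (Suc k) f \<longleftrightarrow>
     (\<forall>x. f differentiable (at x)) \<and> (\<forall>v. C_fun k (\<lambda>x. frechet_derivative f (at x) v))"

definition riemannian_metric :: "('a::euclidean_space \<Rightarrow> 'a \<Rightarrow> 'a \<Rightarrow> real) \<Rightarrow> bool" where
  "riemannian_metric g \<longleftrightarrow>
     (\<forall>x. bilinear (g x)) \<and>
     (\<forall>x u v. g x u v = g x v u) \<and>
     (\<forall>x u. u \<noteq> 0 \<longrightarrow> g x u u > 0) \<and>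
     (\<forall>u v k. C_fun k (\<lambda>x. g x u v))"

text \<open>
  A connection is given by its Christoffel symbols \<open>C x u v = \<Sum> \<Gamma>\<^sup>k\<^sub>i\<^sub>j(x) u\<^sup>i v\<^sup>j e\<^sub>k\<close>, that is,
  \<open>\<nabla>\<^sub>U V = DV(U) + C(U, V)\<close>. For constant fields \<open>u, v, w\<close>, vanishing torsion is the symmetry of
  \<open>C x\<close>, and compatibility with the metric is \<open>u(g(v,w)) = g(\<nabla>\<^sub>u v, w) + g(v, \<nabla>\<^sub>u w)\<close>.
\<close>

definition is_levi_civita ::
    "('a::euclidean_space \<Rightarrow> 'a \<Rightarrow> 'a \<Rightarrow> real) \<Rightarrow> ('a \<Rightarrow> 'a \<Rightarrow> 'a \<Rightarrow> 'a) \<Rightarrow> bool" where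
  "is_levi_civita g C \<longleftrightarrow>
     (\<forall>x. bilinear (C x)) \<and>
     (\<forall>x u v. C x u v = C x v u) \<and>
     (\<forall>x u v w. frechet_derivative (\<lambda>y. g y v w) (at x) u = g x (C x u v) w + g x v (C x u w))"

definition levi_civita ::
    "('a::euclidean_space \<Rightarrow> 'a \<Rightarrow> 'a \<Rightarrow> real) \<Rightarrow> ('a \<Rightarrow> 'a \<Rightarrow> 'a \<Rightarrow> 'a)" where
  "levi_civita g = (THE C. is_levi_civita g C)"

text \<open>
  \<open>R(u,v)w = \<nabla>\<^sub>u \<nabla>\<^sub>v w - \<nabla>\<^sub>v \<nabla>\<^sub>u w\<close> for constant fields, whose Lie brackets vanish.
\<close>

definition curvature ::
    "('a::euclidean_space \<Rightarrow> 'a \<Rightarrow> 'a \<Rightarrow> 'a) \<Rightarrow> 'a \<Rightarrow> 'a \<Rightarrow> 'a \<Rightarrow> 'a \<Rightarrow> 'a" where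
  "curvature C x u v w =
     frechet_derivative (\<lambda>y. C y v w) (at x) u + C x u (C x v w)
     - frechet_derivative (\<lambda>y. C y u w) (at x) v - C x v (C x u w)"

definition flat_metric :: "('a::euclidean_space \<Rightarrow> 'a \<Rightarrow> 'a \<Rightarrow> real) \<Rightarrow> bool" where
  "flat_metric g \<longleftrightarrow> (\<forall>x u v w. curvature (levi_civita g) x u v w = 0)"

text \<open>\<open>D k\<close> is the \<open>k\<close>-th derivative of \<open>c\<close>, one-sided at the end points of the interval.\<close>

definition smooth_curve :: "real \<Rightarrow> real \<Rightarrow> (real \<Rightarrow> 'a::real_normed_vector) \<Rightarrow> bool" where
  "smooth_curve a b c \<longleftrightarrow>
     (\<exists>D. \<forall>t\<in>{a..b}. D 0 t = c t \<and>
        (\<forall>k::nat. (D k has_vector_derivative D (Suc k) t) (at t within {a..b})))"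

text \<open>\<open>V\<close> is parallel along \<open>c\<close>: the covariant derivative \<open>V' + C(c', V)\<close> vanishes.\<close>

definition parallel_along ::
    "('a::euclidean_space \<Rightarrow> 'a \<Rightarrow> 'a \<Rightarrow> real) \<Rightarrow> real \<Rightarrow> real \<Rightarrow> (real \<Rightarrow> 'a) \<Rightarrow> (real \<Rightarrow> 'a) \<Rightarrow> bool" where
  "parallel_along g a b c V \<longleftrightarrow>
     (\<forall>t\<in>{a..b}. (V has_vector_derivative
         - levi_civita g (c t) (vector_derivative c (at t within {a..b})) (V t)) (at t within {a..b}))"

section \<open>Left invariant metrics\<close>

text \<open>From here on \<open>G\<close> is a Lie group whose underlying manifold is the vector space \<^typ>\<open>'a\<close>.\<close>

definition left_translation_deriv ::
    "('a::euclidean_space) monoid \<Rightarrow> 'a \<Rightarrow> 'a \<Rightarrow> 'a \<Rightarrow> 'a" where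
  "left_translation_deriv G h x = frechet_derivative (\<lambda>y. h \<otimes>\<^bsub>G\<^esub> y) (at x)"

definition left_invariant ::
    "('a::euclidean_space) monoid \<Rightarrow> ('a \<Rightarrow> 'a \<Rightarrow> 'a \<Rightarrow> real) \<Rightarrow> bool" where
  "left_invariant G g \<longleftrightarrow>
     (\<forall>h\<in>carrier G. \<forall>x\<in>carrier G. \<forall>u v.
        g (h \<otimes>\<^bsub>G\<^esub> x) (left_translation_deriv G h x u) (left_translation_deriv G h x v) = g x u v)"

section \<open>Holonomy of a quotient by a discrete subgroup\<close>

text \<open>
  The points of \<open>\<Gamma>\G\<close> are the orbits \<open>\<Gamma> x\<close>, i.e. the elements of \<open>rcosets\<^bsub>G\<^esub> \<Gamma>\<close>; its smooth structure
  and its Riemannian metric are the ones for which the projection \<open>G \<rightarrow> \<Gamma>\G\<close> is a local isometry,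
  and its tangent bundle is the quotient of that of \<open>G\<close> by the action
  \<open>\<gamma>(x, v) = (\<gamma>x, dL\<^sub>\<gamma> v)\<close>. The tangent vector \<open>(dproj)\<^sub>x v\<close> at \<open>\<Gamma> x\<close> is thus the orbit of \<open>(x, v)\<close>.
\<close>

definition proj_deriv ::
    "('a::euclidean_space) monoid \<Rightarrow> 'a set \<Rightarrow> 'a \<Rightarrow> 'a \<Rightarrow> ('a \<times> 'a) set" where
  "proj_deriv G \<Gamma> x v = {(h \<otimes>\<^bsub>G\<^esub> x, left_translation_deriv G h x v) | h. h \<in> \<Gamma>}"

definition quotient_tangent_space ::
    "('a::euclidean_space) monoid \<Rightarrow> 'a set \<Rightarrow> 'a set \<Rightarrow> ('a \<times> 'a) set set" where
  "quotient_tangent_space G \<Gamma> p = {proj_deriv G \<Gamma> x v | x v. x \<in> p}"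

definition unit_interval_partition :: "nat \<Rightarrow> (nat \<Rightarrow> real) \<Rightarrow> bool" where
  "unit_interval_partition m \<tau> \<longleftrightarrow> \<tau> 0 = 0 \<and> \<tau> m = 1 \<and> (\<forall>i<m. \<tau> i < \<tau> (Suc i))"

text \<open>
  Curves in \<open>\<Gamma>\G\<close> are parametrized by \<open>[0,1]\<close>; values outside are irrelevant. Smoothness, and
  parallelism of a vector field, are local, and in \<open>\<Gamma>\G\<close> the charts are local inverses of the
  projection; so both are expressed, piece by piece, by lifts to \<open>G\<close>. The lifts on adjacent
  pieces need not fit together in \<open>G\<close>, only their projections do.
\<close>

definition piecewise_smooth_curve ::
    "('a::euclidean_space) monoid \<Rightarrow> 'a set \<Rightarrow> (real \<Rightarrow> 'a set) \<Rightarrow> bool" where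
  "piecewise_smooth_curve G \<Gamma> c \<longleftrightarrow>
     (\<exists>m \<tau>. unit_interval_partition m \<tau> \<and>
        (\<forall>i<m. \<exists>c'. smooth_curve (\<tau> i) (\<tau> (Suc i)) c' \<and>
           (\<forall>t\<in>{\<tau> i..\<tau> (Suc i)}. c' t \<in> carrier G \<and> c t = \<Gamma> #>\<^bsub>G\<^esub> c' t)))"

definition parallel_field ::
    "('a::euclidean_space) monoid \<Rightarrow> 'a set \<Rightarrow> ('a \<Rightarrow> 'a \<Rightarrow> 'a \<Rightarrow> real) \<Rightarrow>
      (real \<Rightarrow> 'a set) \<Rightarrow> (real \<Rightarrow> ('a \<times> 'a) set) \<Rightarrow> bool" where
  "parallel_field G \<Gamma> g c W \<longleftrightarrow>
     (\<exists>m \<tau>. unit_interval_partition m \<tau> \<and>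
        (\<forall>i<m. \<exists>c' V. smooth_curve (\<tau> i) (\<tau> (Suc i)) c' \<and>
           parallel_along g (\<tau> i) (\<tau> (Suc i)) c' V \<and>
           (\<forall>t\<in>{\<tau> i..\<tau> (Suc i)}. c' t \<in> carrier G \<and> c t = \<Gamma> #>\<^bsub>G\<^esub> c' t \<and>
              W t = proj_deriv G \<Gamma> (c' t) (V t))))"

definition parallel_transport ::
    "('a::euclidean_space) monoid \<Rightarrow> 'a set \<Rightarrow> ('a \<Rightarrow> 'a \<Rightarrow> 'a \<Rightarrow> real) \<Rightarrow>
      (real \<Rightarrow> 'a set) \<Rightarrow> ('a \<times> 'a) set \<Rightarrow> ('a \<times> 'a) set" where
  "parallel_transport G \<Gamma> g c =
     (\<lambda>w\<in>quotient_tangent_space G \<Gamma> (c 0).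
        THE z. \<exists>W. parallel_field G \<Gamma> g c W \<and> W 0 = w \<and> W 1 = z)"

text \<open>The holonomy group at \<open>p\<close> of the metric induced by \<open>g\<close>, with composition as product.\<close>

definition holonomy_group ::
    "('a::euclidean_space) monoid \<Rightarrow> 'a set \<Rightarrow> ('a \<Rightarrow> 'a \<Rightarrow> 'a \<Rightarrow> real) \<Rightarrow> 'a set \<Rightarrow>
      (('a \<times> 'a) set \<Rightarrow> ('a \<times> 'a) set) monoid" where
  "holonomy_group G \<Gamma> g p =
     BijGroup (quotient_tangent_space G \<Gamma> p)
       \<lparr>carrier := {parallel_transport G \<Gamma> g c | c.
                     piecewise_smooth_curve G \<Gamma> c \<and> c 0 = p \<and> c 1 = p}\<rparr>"

section \<open>Almost abelian groups\<close>

definition general_linear_group :: "(real^'n^'n) monoid" where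
  "general_linear_group = \<lparr>carrier = {A. invertible A}, monoid.mult = (**), one = mat 1\<rparr>"

definition semidirect_real :: "(real \<Rightarrow> real^'i^'i) \<Rightarrow> (real \<times> (real^'i)) monoid" where
  "semidirect_real \<phi> =
     \<lparr>carrier = UNIV,
      monoid.mult = (\<lambda>(t, v) (t', v'). (t + t', v + \<phi> t *v v')),
      one = (0, 0)\<rparr>"

definition theta :: "real \<Rightarrow> real^2^2" where
  "theta t = vector [vector [cos t, sin t], vector [- sin t, cos t]]"

text \<open>
  The matrix \<open>\<phi>(t)\<close> of size \<open>s + 2n\<close>. The coordinates of \<^typ>\<open>real^'i\<close> are numbered from \<open>0\<close> by a
  bijection \<open>num\<close> from \<^typ>\<open>'i\<close> onto \<open>{..<s + 2 * n}\<close> (which fixes the cardinality of \<^typ>\<open>'i\<close>). A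
  coordinate with number \<open>p \<ge> s\<close> is at position \<open>pos p\<close> in the \<open>blk p\<close>-th rotation block, with
  \<open>1 \<le> blk p \<le> n\<close>.
\<close>

definition almost_abelian_action ::
    "('i \<Rightarrow> nat) \<Rightarrow> nat \<Rightarrow> (nat \<Rightarrow> real) \<Rightarrow> real \<Rightarrow> real^'i^'i" where
  "almost_abelian_action num s a t = (\<chi> i j.
     let p = num i; q = num j;
         blk = (\<lambda>r. (r - s) div 2 + 1);
         pos = (\<lambda>r. if even (r - s) then 1 else 2 :: 2)
     in if p < s \<or> q < s then (if p = q then 1 else 0)
        else if blk p = blk q then theta (a (blk p) * t) $ pos p $ pos q
        else 0)"

definition integer_matrix :: "real^'m^'n \<Rightarrow> bool" where
  "integer_matrix A \<longleftrightarrow> (\<forall>i j. A $ i $ j \<in> \<int>)"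

text \<open>\<open>t\<^sub>0\<int> \<ltimes> P\<int>\<^sup>m\<close> as a subset of \<open>\<real> \<ltimes> \<real>\<^sup>m\<close>.\<close>

definition semidirect_lattice :: "real \<Rightarrow> real^'i^'i \<Rightarrow> (real \<times> (real^'i)) set" where
  "semidirect_lattice t0 P = {(t0 * of_int k, P *v z) | k z. \<forall>i. z $ i \<in> \<int>}"

end

theory Submission
  imports Defs
begin

text \<open>
  Write \<open>A\<close> for the generator of \<open>\<phi>\<close> and split the Lie algebra orthogonally as \<open>\<real>(1, b) \<oplus> V\<close>, where \<open>V\<close> is
  the abelian ideal. If \<open>S\<close> is the symmetric part of \<open>A\<close> on \<open>V\<close>, then the curvature component
  \<open>R((1, b), v)(1, b)\<close> is \<open>(SA - AS + S\<^sup>2) v\<close>; pairing it with an eigenvector of \<open>S\<close> shows that flatness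
  forces \<open>S = 0\<close>. Then \<open>(\<tau>, \<eta>)\<close> is parallel along a curve exactly when \<open>(\<tau>, \<eta> - \<tau> \<phi>(r) b)\<close> is constant,
  \<open>r\<close> being the first coordinate of the curve. In this parallel frame \<open>(k t\<^sub>0, P z) \<in> \<Gamma>\<close> acts by
  \<open>id \<oplus> \<phi>(k t\<^sub>0)\<close>, so transport along a loop depends only on how often the loop winds around
  \<open>\<real>/t\<^sub>0\<int>\<close>, and the holonomy group is the cyclic group generated by \<open>\<phi>(t\<^sub>0)\<close>. The powers of \<open>\<phi>(t\<^sub>0)\<close> are
  bounded and conjugate to integer matrices, so this group is finite; its order is the least common
  multiple of the orders of the blocks.
\<close>

section \<open>Self-adjoint operators and the Levi-Civita connection\<close>

text \<open>Riesz representation for a form that need not be the ambient inner product: definiteness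
  makes \<open>z \<mapsto> B z\<close> injective, hence surjective by dimension. It replaces
  adjoints with respect to the metric below.\<close>

lemma posdef_representation:
  fixes B :: "'a::euclidean_space \<Rightarrow> 'a \<Rightarrow> real"
  assumes B: "bilinear B" and pos: "\<And>x. x \<noteq> 0 \<Longrightarrow> B x x > 0" and f: "linear f"
  shows "\<exists>z. \<forall>y. B z y = f y"
proof -
  define L where "L z = (\<Sum>b\<in>Basis. B z b *\<^sub>R b)" for z
  have represent: "h y = (\<Sum>b\<in>Basis. h b *\<^sub>R b) \<bullet> y" if "linear h" for h :: "'a \<Rightarrow> real" and y
  proof -
    have "h y = h (\<Sum>b\<in>Basis. (y \<bullet> b) *\<^sub>R b)" by (simp add: euclidean_representation)
    also have "\<dots> = (\<Sum>b\<in>Basis. (y \<bullet> b) * h b)" by (simp add: linear_sum[OF that] linear_scale[OF that])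
    finally show ?thesis by (simp add: inner_sum_left inner_sum_right inner_commute mult.commute)
  qed
  have B_L: "B z y = L z \<bullet> y" for z y
    unfolding L_def using B by (intro represent) (auto simp: bilinear_def)
  have "linear L"
    unfolding L_def using B
    by (auto intro!: linearI simp: bilinear_ladd bilinear_lmul scaleR_left_distrib sum.distrib scaleR_sum_right)
  moreover have "inj L"
  proof (subst linear_injective_0[OF \<open>linear L\<close>], intro allI impI)
    fix z assume "L z = 0"
    then have "B z z = 0" using B_L[of z z] by simp
    then show "z = 0" using pos[of z] by force
  qed
  ultimately have "surj L" by (rule linear_injective_imp_surjective) simp
  then obtain z where "L z = (\<Sum>b\<in>Basis. f b *\<^sub>R b)" by (metis surjD)
  then show ?thesis using represent[OF f] B_L by metis
qed

lemma posdef_nondegenerate: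
  fixes B :: "'a::euclidean_space \<Rightarrow> 'a \<Rightarrow> real"
  assumes "bilinear B" and "\<And>x. x \<noteq> 0 \<Longrightarrow> B x x > 0" and "\<And>y. B u y = B v y"
  shows "u = v"
  using assms(2)[of "u - v"] assms(3)[of "u - v"] by (force simp: bilinear_lsub[OF assms(1)])

text \<open>Maximise the Rayleigh quotient over the compact Euclidean sphere; it is homogeneous of
  degree 0, so its maximum \<open>l\<close> bounds it everywhere. The form
  \<open>l * B y y - B (S y) y\<close> is then positive semidefinite and vanishes at the maximiser
  \<open>x\<close>, which puts \<open>x\<close> in its kernel.\<close>

lemma selfadjoint_max_eigenvector:
  fixes B :: "'a::euclidean_space \<Rightarrow> 'a \<Rightarrow> real"
  assumes B: "bilinear B" and sym: "\<And>x y. B x y = B y x" and pos: "\<And>x. x \<noteq> 0 \<Longrightarrow> B x x > 0"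
    and S: "linear S" and adj: "\<And>x y. B (S x) y = B x (S y)" and nontrivial: "(e::'a) \<noteq> 0"
  obtains x l where "x \<noteq> 0" "S x = l *\<^sub>R x" "\<And>y. B (S y) y \<le> l * B y y"
proof -
  have "continuous_on (sphere 0 1) (\<lambda>y. B (S y) y / B y y)"
  proof (intro continuous_on_divide bilinear_continuous_on_compose[OF _ _ B] continuous_on_id
      linear_continuous_on)
    show "bounded_linear S" using S by (simp add: linear_conv_bounded_linear)
    show "\<forall>x\<in>sphere 0 1. B x x \<noteq> 0"
    proof
      fix x :: 'a assume "x \<in> sphere 0 1"
      then have "x \<noteq> 0" by auto
      then show "B x x \<noteq> 0" using pos by force
    qed
  qed
  moreover have "compact (sphere (0::'a) 1)" by simp
  moreover have "sphere (0::'a) 1 \<noteq> {}"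
    using nontrivial by (auto intro!: exI[of _ "(1 / norm e) *\<^sub>R e"] simp: set_eq_iff)
  ultimately obtain x where x: "norm x = 1"
    and max: "\<And>y. norm y = 1 \<Longrightarrow> B (S y) y / B y y \<le> B (S x) x / B x x"
    using continuous_attains_sup[of "sphere (0::'a) 1" "\<lambda>y. B (S y) y / B y y"] by auto
  define l where "l = B (S x) x / B x x"
  have x0: "x \<noteq> 0" using x by auto
  note simps = bilinear_ladd[OF B] bilinear_radd[OF B] bilinear_lmul[OF B] bilinear_rmul[OF B]
    bilinear_lsub[OF B] bilinear_rsub[OF B] linear_add[OF S] linear_scale[OF S] linear_diff[OF S]
  have le: "B (S y) y \<le> l * B y y" for y
  proof (cases "y = 0")
    case True
    then show ?thesis using bilinear_rzero[OF B] by simp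
  next
    case False
    then have "B (S ((1 / norm y) *\<^sub>R y)) ((1 / norm y) *\<^sub>R y)
        / B ((1 / norm y) *\<^sub>R y) ((1 / norm y) *\<^sub>R y) \<le> l"
      unfolding l_def by (intro max) simp
    then have "B (S y) y / B y y \<le> l"
      using False by (simp add: simps)
    then show ?thesis using pos[OF False] by (simp add: field_simps)
  qed
  have eq: "B (S x) x = l * B x x" using pos[OF x0] by (simp add: l_def)
  have F0: "l * B x y - B (S x) y = 0" for y
  proof -
    define F where "F = l * B x y - B (S x) y"
    define Q where "Q = l * B y y - B (S y) y"
    have Q: "Q \<ge> 0" using le by (simp add: Q_def)
    \<comment> \<open>The quadratic 2tF + t^2 Q is nonnegative for every t. This value turns it into
      -t^2 (Q + 2), and the summand 1 in the denominator avoids dividing by zero when Q = 0.\<close>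
    define t where "t = - F / (Q + 1)"
    have "l * B (x + t *\<^sub>R y) (x + t *\<^sub>R y) - B (S (x + t *\<^sub>R y)) (x + t *\<^sub>R y) = 2 * t * F + t\<^sup>2 * Q"
      using eq adj[of y x] sym[of y x] sym[of y "S x"]
      by (simp add: simps F_def Q_def algebra_simps power2_eq_square)
    then have "0 \<le> 2 * t * F + t\<^sup>2 * Q" using le[of "x + t *\<^sub>R y"] by simp
    also have F: "F = - t * (Q + 1)" using Q by (simp add: t_def)
    finally have "t\<^sup>2 * (Q + 2) \<le> 0" by (simp add: algebra_simps power2_eq_square)
    then have "t = 0" using Q mult_pos_pos[of "t\<^sup>2" "Q + 2"] by (smt (verit) zero_less_power2)
    with F have "F = 0" by simp
    then show ?thesis by (simp add: F_def)
  qed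
  have "S x = l *\<^sub>R x"
  proof (rule posdef_nondegenerate[OF B pos])
    fix y show "B (S x) y = B (l *\<^sub>R x) y" using F0[of y] by (simp add: simps)
  qed
  with x0 le show ?thesis by (intro that)
qed

text \<open>The largest eigenvalues of S and of -S both vanish, which bounds the quadratic form of S
  from both sides by zero; polarisation then gives S = 0.\<close>

lemma selfadjoint_eq_zero:
  fixes B :: "'a::euclidean_space \<Rightarrow> 'a \<Rightarrow> real"
  assumes B: "bilinear B" and sym: "\<And>x y. B x y = B y x" and pos: "\<And>x. x \<noteq> 0 \<Longrightarrow> B x x > 0"
    and S: "linear S" and adj: "\<And>x y. B (S x) y = B x (S y)"
    and eigen: "\<And>x l. S x = l *\<^sub>R x \<Longrightarrow> x \<noteq> 0 \<Longrightarrow> l = 0"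
  shows "S x = 0"
proof (cases "x = 0")
  case True
  then show ?thesis by (simp add: linear_0[OF S])
next
  case False
  have upper: "B (S y) y \<le> 0" for y
    using selfadjoint_max_eigenvector[OF B sym pos S adj False] eigen
    by (metis mult_zero_left)
  have lower: "B (- S y) y \<le> 0" for y
  proof -
    have S': "linear (\<lambda>x. - S x)" using S by (simp add: linear_compose_neg)
    obtain z l where "z \<noteq> 0" "- S z = l *\<^sub>R z" and le: "\<And>y. B (- S y) y \<le> l * B y y"
      using selfadjoint_max_eigenvector[OF B sym pos S' _ False] adj
      by (metis bilinear_lneg[OF B] bilinear_rneg[OF B])
    then have "S z = (- l) *\<^sub>R z" by (metis minus_minus scaleR_minus_left)
    with eigen \<open>z \<noteq> 0\<close> have "l = 0" by fastforce
    with le show ?thesis by simp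
  qed
  have zero: "B (S y) y = 0" for y
    using upper[of y] lower[of y] by (simp add: bilinear_lneg[OF B])
  have "B (S x) y = B 0 y" for y
    using zero[of "x + y"] zero[of x] zero[of y] adj[of y x] sym[of y "S x"] bilinear_lzero[OF B]
    by (simp add: linear_add[OF S] bilinear_ladd[OF B] bilinear_radd[OF B])
  then show ?thesis using posdef_nondegenerate[OF B pos, of "S x" 0] by blast
qed

text \<open>The difference \<open>T\<close> of two candidates is symmetric in its first two
  arguments and skew in its last two, hence zero. So the \<open>THE\<close> in
  \<open>levi_civita\<close> can be evaluated by exhibiting one solution.\<close>

lemma levi_civita_eqI:
  assumes g: "riemannian_metric g" and C: "is_levi_civita g C"
  shows "levi_civita g = C"
  unfolding levi_civita_def
proof (rule the_equality)
  fix C' assume C': "is_levi_civita g C'"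
  show "C' = C"
  proof (intro ext)
    fix x u v
    have B: "bilinear (g x)" and pos: "\<And>u. u \<noteq> 0 \<Longrightarrow> g x u u > 0" and sym: "\<And>u v. g x u v = g x v u"
      using g by (auto simp: riemannian_metric_def)
    define T where "T u v w = g x (C' x u v) w - g x (C x u v) w" for u v w
    have "T u v w = T v u w" and "T u v w = - T u w v" for u v w
      using C C' sym[of "C x u w" v] sym[of "C' x u w" v]
      unfolding T_def is_levi_civita_def by (smt (verit))+
    then have "T u v w = 0" for u v w by (smt (verit))
    then show "C' x u v = C x u v"
      by (intro posdef_nondegenerate[OF B pos]) (auto simp: T_def)
  qed
qed (rule C)

section \<open>Flat left invariant metrics\<close>

lemma bounded_bilinear_matrix_vector_mult:
  "bounded_bilinear ((*v) :: real^'n^'m \<Rightarrow> real^'n \<Rightarrow> real^'m)"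
  by (auto simp: bilinear_conv_bounded_bilinear[symmetric] bilinear_def matrix_vector_mult_add_rdistrib
      scaleR_matrix_vector_assoc intro!: linearI)

lemma matrix_vector_mult_minus_right [simp]: "M *v (- x) = - (M *v x)" for M :: "real^'n^'m"
  by (simp add: linear_neg)

text \<open>The geometry is done for an arbitrary one-parameter group with generator A. Rotations
  enter later, through their bounded entries and their periods.\<close>

locale matrix_flow =
  fixes \<phi> :: "real \<Rightarrow> real^'i^'i" and A :: "real^'i^'i"
  assumes flow_0 [simp]: "\<phi> 0 = mat 1"
    and flow_add: "\<phi> (r + t) = \<phi> r ** \<phi> t"
    and flow_deriv: "(\<phi> has_vector_derivative A ** \<phi> t) (at t)"
begin

lemma flow_flow [simp]: "\<phi> r *v (\<phi> t *v x) = \<phi> (r + t) *v x"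
  by (simp add: flow_add matrix_vector_mul_assoc)

lemma flow_vector_deriv:
  assumes "(r has_real_derivative r') (at t within T)" and "(f has_vector_derivative f') (at t within T)"
  shows "((\<lambda>t. \<phi> (r t) *v f t) has_vector_derivative
      \<phi> (r t) *v f' + r' *\<^sub>R (A *v (\<phi> (r t) *v f t))) (at t within T)"
proof -
  have "((\<lambda>t. \<phi> (r t)) has_vector_derivative r' *\<^sub>R (A ** \<phi> (r t))) (at t within T)"
    using vector_diff_chain_within[OF assms(1)[unfolded has_real_derivative_iff_has_vector_derivative]
        has_vector_derivative_at_within[OF flow_deriv]]
    by (simp add: o_def)
  from bounded_bilinear.has_vector_derivative[OF bounded_bilinear_matrix_vector_mult this assms(2)]
  show ?thesis
    by (simp add: scaleR_matrix_vector_assoc matrix_vector_mul_assoc)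
qed

lemma flow_const_deriv:
  assumes "(r has_real_derivative r') (at t within T)"
  shows "((\<lambda>t. \<phi> (r t) *v x) has_vector_derivative r' *\<^sub>R (A *v (\<phi> (r t) *v x))) (at t within T)"
  using flow_vector_deriv[OF assms has_vector_derivative_const[of x]] by simp

text \<open>Both sides are the derivative at r = 0 of \<phi>(r + t) = \<phi>(t) \<phi>(r), factored
  in the two possible orders.\<close>

lemma generator_commute: "A *v (\<phi> t *v x) = \<phi> t *v (A *v x)"
proof -
  have "((\<lambda>r. \<phi> (r + t) *v x) has_vector_derivative A *v (\<phi> t *v x)) (at 0)"
    using flow_const_deriv[of "\<lambda>r. r + t" 1 0 UNIV x] DERIV_shift[of "\<lambda>r. r" 1 0 t] by simp
  moreover have "((\<lambda>r. \<phi> t *v (\<phi> r *v x)) has_vector_derivative \<phi> t *v (A *v x)) (at 0)"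
    using flow_const_deriv[of "\<lambda>r. r" 1 0 UNIV x]
    by (intro bounded_linear.has_vector_derivative[OF matrix_vector_mul_bounded_linear]) simp
  ultimately show ?thesis
    by (auto simp: add.commute dest: vector_derivative_unique_at)
qed

end

text \<open>Left translations by the abelian ideal have constant differential the identity, so a
  left invariant metric and its Christoffel symbols depend on the first coordinate alone. Their
  Frechet derivatives thus reduce to derivatives in one real variable.\<close>

lemma has_derivative_fst_compose:
  assumes "(h has_vector_derivative h') (at (fst x))"
  shows "((\<lambda>y. h (fst y)) has_derivative (\<lambda>u. fst u *\<^sub>R h')) (at x)"
  using diff_chain_at[OF bounded_linear_imp_has_derivative[OF bounded_linear_fst]
      assms[unfolded has_vector_derivative_def]]
  by (simp add: o_def)

lemma frechet_derivative_fst_compose: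
  assumes "(h has_vector_derivative h') (at (fst x))"
  shows "frechet_derivative (\<lambda>y. h (fst y)) (at x) u = fst u *\<^sub>R h'"
  using frechet_derivative_at[OF has_derivative_fst_compose[OF assms]] by metis

lemma left_translation_deriv_semidirect:
  "left_translation_deriv (semidirect_real \<phi>) h x u = (fst u, \<phi> (fst h) *v snd u)"
proof -
  have "((\<lambda>y. h \<otimes>\<^bsub>semidirect_real \<phi>\<^esub> y) has_derivative (\<lambda>u. (fst u, \<phi> (fst h) *v snd u))) (at x)"
    unfolding semidirect_real_def
    by (auto simp: case_prod_unfold intro!: derivative_eq_intros
        bounded_linear.has_derivative[OF matrix_vector_mul_bounded_linear])
  from frechet_derivative_at[OF this] show ?thesis
    unfolding left_translation_deriv_def by metis
qed

lemma is_levi_civitaI: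
  assumes "\<And>x. bilinear (C x)" and "\<And>x u v. C x u v = C x v u"
    and "\<And>x u v w. frechet_derivative (\<lambda>y. g y v w) (at x) u = g x (C x u v) w + g x v (C x u w)"
  shows "is_levi_civita g C"
  using assms by (simp add: is_levi_civita_def)

section \<open>The Levi-Civita connection of a left invariant metric\<close>

locale left_invariant_metric = matrix_flow \<phi> A
  for \<phi> :: "real \<Rightarrow> real^'i^'i" and A +
  fixes g :: "(real \<times> (real^'i)) \<Rightarrow> (real \<times> (real^'i)) \<Rightarrow> (real \<times> (real^'i)) \<Rightarrow> real"
  assumes metric: "riemannian_metric g"
    and invariant: "left_invariant (semidirect_real \<phi>) g"
begin

lemma metric_bilinear: "bilinear (g x)" and metric_sym: "g x u v = g x v u"
  and metric_pos: "u \<noteq> 0 \<Longrightarrow> g x u u > 0"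
  using metric by (simp_all add: riemannian_metric_def del: split_paired_All)

lemma metric_at_unit:
  "g x u v = g 0 (fst u, \<phi> (- fst x) *v snd u) (fst v, \<phi> (- fst x) *v snd v)"
proof -
  have "g (x \<otimes>\<^bsub>semidirect_real \<phi>\<^esub> 0)
      (left_translation_deriv (semidirect_real \<phi>) x 0 (fst u, \<phi> (- fst x) *v snd u))
      (left_translation_deriv (semidirect_real \<phi>) x 0 (fst v, \<phi> (- fst x) *v snd v)) =
    g 0 (fst u, \<phi> (- fst x) *v snd u) (fst v, \<phi> (- fst x) *v snd v)"
    by (intro invariant[unfolded left_invariant_def, rule_format]) (simp_all add: semidirect_real_def)
  then show ?thesis
    unfolding left_translation_deriv_semidirect
    by (simp add: semidirect_real_def case_prod_unfold)
qed

definition B :: "real^'i \<Rightarrow> real^'i \<Rightarrow> real" where "B x y = g 0 (0, x) (0, y)"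

lemma B_bilinear: "bilinear B"
proof -
  have "linear (\<lambda>y. (0::real, y :: real^'i))" by (auto intro!: linearI)
  then show ?thesis
    using metric_bilinear[of 0] linear_compose unfolding bilinear_def B_def o_def by fastforce
qed

lemma B_sym: "B x y = B y x"
  by (simp add: B_def metric_sym)

lemma B_pos: "x \<noteq> 0 \<Longrightarrow> B x x > 0"
  by (simp add: B_def metric_pos zero_prod_def)

lemmas B_simps = bilinear_ladd[OF B_bilinear] bilinear_radd[OF B_bilinear]
  bilinear_lmul[OF B_bilinear] bilinear_rmul[OF B_bilinear]
  bilinear_lsub[OF B_bilinear] bilinear_rsub[OF B_bilinear]
  bilinear_lneg[OF B_bilinear] bilinear_rneg[OF B_bilinear]
  bilinear_lzero[OF B_bilinear] bilinear_rzero[OF B_bilinear]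

text \<open>This is the normal to the ideal, scaled to have first coordinate 1: \<open>b\<close>
  represents y \<mapsto> -g((1,0),(0,y)) with respect to \<open>B\<close>. Its squared length
  becomes the constant \<open>c\<close>.\<close>

lemma normal_vector_exists: "\<exists>b. \<forall>y. g 0 (1, b) (0, y) = 0"
proof -
  have "linear (\<lambda>y. - g 0 (1, 0) (0, y))"
    using bilinear_radd[OF metric_bilinear, of 0 "(1, 0)" "(0, _)" "(0, _)"]
      bilinear_rmul[OF metric_bilinear, of 0 "(1, 0)" _ "(0, _)"]
    by (intro linearI) simp_all
  then obtain b where "\<forall>y. B b y = - g 0 (1, 0) (0, y)"
    using posdef_representation[OF B_bilinear B_pos] by metis
  moreover have "g 0 (1, b) (0, y) = g 0 (1, 0) (0, y) + B b y" for b y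
    using bilinear_ladd[OF metric_bilinear, of 0 "(1, 0)" "(0, b)" "(0, y)"] by (simp add: B_def)
  ultimately show ?thesis by (metis add.right_inverse)
qed

lemma symmetric_part_exists: "\<exists>S :: real^'i^'i. \<forall>x y. 2 * B (S *v x) y = B (A *v x) y + B x (A *v y)"
proof -
  have "linear (\<lambda>y. (B (A *v x) y + B x (A *v y)) / 2)" for x
    by (auto intro!: linearI simp: B_simps algebra_simps add_divide_distrib)
  then have "\<exists>z. \<forall>y. B z y = (B (A *v x) y + B x (A *v y)) / 2" for x
    by (intro posdef_representation[OF B_bilinear B_pos])
  then obtain S where S: "\<And>x y. B (S x) y = (B (A *v x) y + B x (A *v y)) / 2" by metis
  have "linear S"
    by (intro linearI posdef_nondegenerate[OF B_bilinear B_pos])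
      (simp_all add: S B_simps algebra_simps add_divide_distrib)
  then show ?thesis
    by (intro exI[of _ "matrix S"]) (simp add: matrix_works S)
qed

definition b :: "real^'i" where "b = (SOME b. \<forall>y. g 0 (1, b) (0, y) = 0)"

definition S :: "real^'i^'i" where
  "S = (SOME S. \<forall>x y. 2 * B (S *v x) y = B (A *v x) y + B x (A *v y))"

definition c :: real where "c = g 0 (1, b) (1, b)"

lemma b_orthogonal: "g 0 (1, b) (0, y) = 0"
  using someI_ex[OF normal_vector_exists] by (simp add: b_def)

lemma S_eq: "2 * B (S *v x) y = B (A *v x) y + B x (A *v y)"
  using someI_ex[OF symmetric_part_exists] by (simp add: S_def)

lemma S_selfadjoint: "B (S *v x) y = B x (S *v y)"
  using S_eq[of x y] S_eq[of y x] B_sym[of x] B_sym[of y] by simp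

lemma c_pos: "c > 0"
  by (simp add: c_def metric_pos zero_prod_def)

text \<open>The component of \<open>u\<close>, moved to the unit by a left translation, in \<open>V\<close> along \<open>(1, b)\<close>.\<close>

definition pr :: "real \<times> (real^'i) \<Rightarrow> real \<times> (real^'i) \<Rightarrow> real^'i" where
  "pr x u = \<phi> (- fst x) *v snd u - fst u *\<^sub>R b"

text \<open>Left invariance moves everything to the unit, where (1, b) is orthogonal to the ideal.
  The point now enters only through \<open>pr\<close>, so this is the formula that gets
  differentiated.\<close>

lemma metric_eq: "g x u v = c * fst u * fst v + B (pr x u) (pr x v)"
proof -
  have split: "(fst u, \<phi> (- fst x) *v snd u) = fst u *\<^sub>R (1, b) + (0, pr x u)" for u
    by (simp add: pr_def)
  show ?thesis
    unfolding metric_at_unit[of x] split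
    using b_orthogonal[of "pr x v"] b_orthogonal[of "pr x u"] metric_sym[of 0 "(0, pr x u)" "(1, b)"]
    by (simp add: bilinear_ladd[OF metric_bilinear] bilinear_radd[OF metric_bilinear]
        bilinear_lmul[OF metric_bilinear] bilinear_rmul[OF metric_bilinear] c_def B_def
        del: add_Pair scaleR_Pair)
qed

lemma pr_deriv:
  "((\<lambda>r. pr (r, y) u) has_vector_derivative - (A *v (\<phi> (- r) *v snd u))) (at r)"
proof -
  have "((\<lambda>r. \<phi> (- r) *v snd u) has_vector_derivative - (A *v (\<phi> (- r) *v snd u))) (at r)"
    using flow_const_deriv[of uminus "-1" r UNIV "snd u"] by (simp add: DERIV_minus DERIV_ident)
  then show ?thesis
    unfolding pr_def by (auto intro!: derivative_eq_intros)
qed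

lemma frechet_derivative_metric:
  "frechet_derivative (\<lambda>y. g y v w) (at x) u =
     - fst u * (2 * B (S *v pr x v) (pr x w) + fst v * B (A *v b) (pr x w) + fst w * B (pr x v) (A *v b))"
proof -
  define D where "D = B (pr x v) (- (A *v (\<phi> (- fst x) *v snd w))) + B (- (A *v (\<phi> (- fst x) *v snd v))) (pr x w)"
  have "((\<lambda>r. B (pr (r, snd x) v) (pr (r, snd x) w)) has_vector_derivative D) (at (fst x))"
    using bounded_bilinear.has_vector_derivative[OF B_bilinear[unfolded bilinear_conv_bounded_bilinear]
        pr_deriv[of "snd x" v "fst x"] pr_deriv[of "snd x" w "fst x"]] by (simp add: D_def)
  from has_vector_derivative_add[OF has_vector_derivative_const[of "c * fst v * fst w"] this]
  have "((\<lambda>r. c * fst v * fst w + B (pr (r, snd x) v) (pr (r, snd x) w))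
      has_vector_derivative D) (at (fst x))"
    by (simp only: add_0_left)
  from frechet_derivative_fst_compose[OF this, of u]
  have "frechet_derivative (\<lambda>y. c * fst v * fst w + B (pr (fst y, snd x) v) (pr (fst y, snd x) w)) (at x) u = fst u * D"
    by (simp only: real_scaleR_def)
  moreover have "g y v w = c * fst v * fst w + B (pr (fst y, snd x) v) (pr (fst y, snd x) w)" for y
    unfolding metric_eq[of y] pr_def by (simp only: fst_conv)
  ultimately have deriv: "frechet_derivative (\<lambda>y. g y v w) (at x) u = fst u * D"
    by presburger
  \<comment> \<open>Differentiating \<open>pr\<close> yields A applied to the whole of \<phi>(-r) v,
    including the part along b that \<open>pr\<close> has removed. This is the source of the terms
    with A b.\<close>
  have split: "\<phi> (- fst x) *v snd v = pr x v + fst v *\<^sub>R b" for v by (simp add: pr_def)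
  have "D = - (2 * B (S *v pr x v) (pr x w) + fst v * B (A *v b) (pr x w) + fst w * B (pr x v) (A *v b))"
    unfolding D_def split S_eq
    by (simp add: B_simps matrix_vector_right_distrib matrix_vector_mult_scaleR)
  with deriv show ?thesis by (simp add: algebra_simps)
qed

text \<open>
  In the left invariant frame \<open>\<nabla>\<^sub>X Y = \<rho> K q - \<tau> S p + (B(S p, q) / c) (1, b)\<close> for \<open>X = \<rho>(1, b) + p\<close> and
  \<open>Y = \<tau>(1, b) + q\<close>, with \<open>K\<close> the skew part of \<open>A\<close>. The Christoffel symbols arise by rewriting this in
  the coordinate frame.
\<close>

definition shape :: "real \<times> (real^'i) \<Rightarrow> real \<times> (real^'i) \<Rightarrow> real \<times> (real^'i) \<Rightarrow> real" where
  "shape x u v = B (S *v pr x u) (pr x v) / c"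

definition christoffel ::
    "real \<times> (real^'i) \<Rightarrow> real \<times> (real^'i) \<Rightarrow> real \<times> (real^'i) \<Rightarrow> real \<times> (real^'i)" where
  "christoffel x u v = (shape x u v, \<phi> (fst x) *v
     (shape x u v *\<^sub>R b - fst u *\<^sub>R (S *v pr x v) - fst v *\<^sub>R (S *v pr x u) - (fst u * fst v) *\<^sub>R (A *v b)))"

lemma fst_christoffel [simp]: "fst (christoffel x u v) = shape x u v"
  by (simp add: christoffel_def)

lemma pr_christoffel:
  "pr x (christoffel x u v) =
     - (fst u *\<^sub>R (S *v pr x v)) - fst v *\<^sub>R (S *v pr x u) - (fst u * fst v) *\<^sub>R (A *v b)"
  by (subst pr_def) (simp add: christoffel_def)

lemma pr_linear: "pr x (u + v) = pr x u + pr x v" "pr x (k *\<^sub>R u) = k *\<^sub>R pr x u"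
  by (auto simp: pr_def algebra_simps)

lemma levi_civita_eq: "levi_civita g = christoffel"
proof (rule levi_civita_eqI[OF metric])
  have bilin: "bilinear (christoffel x)" for x
    unfolding bilinear_def christoffel_def shape_def linear_iff
    by (simp add: pr_linear B_simps algebra_simps add_divide_distrib del: split_paired_All)
  have symm: "christoffel x u v = christoffel x v u" for x u v
    using S_selfadjoint B_sym by (simp add: christoffel_def shape_def algebra_simps)
  have compat: "frechet_derivative (\<lambda>y. g y v w) (at x) u =
      g x (christoffel x u v) w + g x v (christoffel x u w)" for x u v w
  proof -
    \<comment> \<open>The other summand follows by exchanging v and w. In the sum the terms with
      \<open>B (S *v pr x u)\<close> cancel in pairs, and what remains carries the factor
      \<open>fst u\<close>, as the derivative of the metric does.\<close>
    have left: "g x (christoffel x u v) w = B (S *v pr x u) (pr x v) * fst w - fst u * B (S *v pr x v) (pr x w)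
        - fst v * B (S *v pr x u) (pr x w) - fst u * fst v * B (A *v b) (pr x w)" for v w
    proof -
      have "c * fst (christoffel x u v) = B (S *v pr x u) (pr x v)"
        using c_pos by (simp add: christoffel_def shape_def)
      then show ?thesis
        unfolding metric_eq[of x "christoffel x u v"] pr_christoffel by (simp add: B_simps)
    qed
    have "g x v (christoffel x u w) = B (S *v pr x u) (pr x w) * fst v - fst u * B (S *v pr x v) (pr x w)
        - fst w * B (S *v pr x u) (pr x v) - fst u * fst w * B (pr x v) (A *v b)"
      unfolding metric_sym[of x v] left
        using S_selfadjoint[of "pr x w" "pr x v"] B_sym[of "pr x w"] B_sym[of "A *v b"] by simp
    with left[of v w] show ?thesis
      unfolding frechet_derivative_metric by (simp add: algebra_simps)
  qed
  from bilin symm compat show "is_levi_civita g christoffel"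
    by (rule is_levi_civitaI)
qed

text \<open>The product rule in the first coordinate: \<open>u'\<close> and \<open>v'\<close> are
  the derivatives of \<open>pr x u\<close> and \<open>pr x v\<close>, \<open>k\<close> is that of
  \<open>shape\<close>, and the last term comes from the factor \<phi> in front.\<close>

lemma christoffel_deriv:
  fixes x u v
  defines "u' \<equiv> - (A *v (\<phi> (- fst x) *v snd u))" and "v' \<equiv> - (A *v (\<phi> (- fst x) *v snd v))"
  defines "k \<equiv> (B (S *v pr x u) v' + B (S *v u') (pr x v)) / c"
  shows "frechet_derivative (\<lambda>y. christoffel y u v) (at x) w =
    fst w *\<^sub>R (k, \<phi> (fst x) *v (k *\<^sub>R b - fst u *\<^sub>R (S *v v') - fst v *\<^sub>R (S *v u')) +
      A *v snd (christoffel x u v))"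
proof -
  have S_pr: "((\<lambda>r. S *v pr (r, snd x) u) has_vector_derivative - (S *v (A *v (\<phi> (- fst x) *v snd u)))) (at (fst x))" for u
    using bounded_linear.has_vector_derivative[OF matrix_vector_mul_bounded_linear pr_deriv[of "snd x" u "fst x"], of S]
    by simp
  have shape: "((\<lambda>r. shape (r, snd x) u v) has_vector_derivative k) (at (fst x))"
    unfolding shape_def
    using has_vector_derivative_divide[OF bounded_bilinear.has_vector_derivative
        [OF B_bilinear[unfolded bilinear_conv_bounded_bilinear] S_pr[of u] pr_deriv[of "snd x" v]], of c]
    by (simp add: k_def u'_def v'_def)
  have inner: "((\<lambda>r. shape (r, snd x) u v *\<^sub>R b - fst u *\<^sub>R (S *v pr (r, snd x) v)
        - fst v *\<^sub>R (S *v pr (r, snd x) u) - (fst u * fst v) *\<^sub>R (A *v b))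
      has_vector_derivative k *\<^sub>R b - fst u *\<^sub>R (S *v v') - fst v *\<^sub>R (S *v u')) (at (fst x))"
    using has_vector_derivative_diff[OF has_vector_derivative_diff[OF has_vector_derivative_diff[OF
        has_vector_derivative_scaleR[OF shape[folded has_real_derivative_iff_has_vector_derivative]
          has_vector_derivative_const[of b]]
        has_vector_derivative_scaleR[OF DERIV_const[of "fst u"] S_pr[of v]]]
        has_vector_derivative_scaleR[OF DERIV_const[of "fst v"] S_pr[of u]]]
        has_vector_derivative_const[of "(fst u * fst v) *\<^sub>R (A *v b)"]]
    by (simp add: u'_def v'_def)
  have deriv: "((\<lambda>r. christoffel (r, snd x) u v) has_vector_derivative
      (k, \<phi> (fst x) *v (k *\<^sub>R b - fst u *\<^sub>R (S *v v') - fst v *\<^sub>R (S *v u')) +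
      A *v snd (christoffel x u v))) (at (fst x))"
    unfolding christoffel_def
    using has_vector_derivative_Pair[OF shape flow_vector_deriv[OF DERIV_ident inner]]
    by simp
  have "christoffel (fst y, snd x) u v = christoffel y u v" for y
    by (simp add: christoffel_def shape_def pr_def)
  with frechet_derivative_fst_compose[OF deriv, of w] show ?thesis
    by simp
qed

section \<open>Curvature and the consequence of flatness\<close>

lemma curvature_at_unit:
  "snd (curvature christoffel 0 (1, b) (0, x) (1, b)) =
     S *v (A *v x) - A *v (S *v x) + S *v (S *v x)"
  \<comment> \<open>The derivative in the direction (0, x) has the factor
    \<open>fst (0, x) = 0\<close>, so only the derivative along (1, b) contributes.\<close>
  unfolding curvature_def christoffel_deriv
  by (simp add: christoffel_def shape_def pr_def B_simps algebra_simps)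

lemma flat_imp_S_eq_zero:
  assumes "flat_metric g"
  shows "S *v x = 0"
proof (rule selfadjoint_eq_zero[where B = B and S = "(*v) S", OF B_bilinear B_sym B_pos matrix_vector_mul_linear S_selfadjoint])
  fix x l assume x: "S *v x = l *\<^sub>R x" "x \<noteq> 0"
  have "S *v (A *v x) - A *v (S *v x) + S *v (S *v x) = 0"
    using assms unfolding curvature_at_unit[symmetric] flat_metric_def levi_civita_eq
    by (simp del: split_paired_All)
  then have "B (S *v (A *v x) - A *v (S *v x) + S *v (S *v x)) x = 0"
    by (simp add: B_simps)
  \<comment> \<open>By self-adjointness the pairings of SAx and of ASx with x both equal l B(Ax, x);
    they cancel and only the square of S is left.\<close>
  then have "l * l * B x x = 0"
    using x(1) S_selfadjoint[of "A *v x" x] by (simp add: B_simps algebra_simps)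
  then show "l = 0" using B_pos[OF x(2)] by simp
qed

text \<open>Only the term with A b survives S = 0. This formula is all that the holonomy computation
  takes over from the metric.\<close>

lemma flat_levi_civita:
  assumes "flat_metric g"
  shows "levi_civita g x u v = (0, - (fst u * fst v) *\<^sub>R (A *v (\<phi> (fst x) *v b)))"
  using flat_imp_S_eq_zero[OF assms]
  by (simp add: levi_civita_eq christoffel_def shape_def B_simps generator_commute matrix_vector_mult_scaleR)

end

section \<open>Parallel transport and holonomy\<close>

text \<open>Distinct values are at least |l| apart, so the image of an interval is a single point.
  It is used to see that two lifts of one curve differ by a constant.\<close>

lemma integer_multiples_continuous_constant:
  fixes f :: "real \<Rightarrow> real"
  assumes "l \<noteq> 0" and "continuous_on {a..b} f" and "\<And>t. t \<in> {a..b} \<Longrightarrow> f t \<in> range (\<lambda>k::int. l * of_int k)"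
  shows "\<exists>r. \<forall>t\<in>{a..b}. f t = r"
proof -
  have "\<exists>e>0. \<forall>u. u \<in> {a..b} \<and> f u \<noteq> f t \<longrightarrow> e \<le> norm (f u - f t)" if t: "t \<in> {a..b}" for t
  proof (intro exI[of _ "\<bar>l\<bar>"] conjI allI impI)
    fix u assume u: "u \<in> {a..b} \<and> f u \<noteq> f t"
    obtain j k :: int where jk: "f u = l * of_int j" "f t = l * of_int k"
      using assms(3)[of u] assms(3)[OF t] u by blast
    with u have "1 \<le> \<bar>j - k\<bar>" by auto
    then have "1 \<le> \<bar>of_int j - of_int k :: real\<bar>" by linarith
    then show "\<bar>l\<bar> \<le> norm (f u - f t)"
      by (simp add: jk abs_mult mult_le_cancel_left1 flip: right_diff_distrib)
  qed (use \<open>l \<noteq> 0\<close> in simp)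
  from continuous_discrete_range_constant[OF connected_Icc assms(2) this]
  have "f constant_on {a..b}" by blast
  then show ?thesis by (simp add: constant_on_def)
qed

section \<open>Partitions of the unit interval and smooth curves\<close>

lemma unit_interval_partition_mono:
  assumes "unit_interval_partition m \<tau>" and "i \<le> j" and "j \<le> m"
  shows "\<tau> i \<le> \<tau> j"
  using assms(2,3)
proof (induction rule: dec_induct)
  case (step k)
  then have "\<tau> k < \<tau> (Suc k)" using assms(1) by (simp add: unit_interval_partition_def)
  with step show ?case by simp
qed simp

lemma unit_interval_partition_subset:
  assumes "unit_interval_partition m \<tau>" and "i < m"
  shows "{\<tau> i..\<tau> (Suc i)} \<subseteq> {0..1}"
  using unit_interval_partition_mono[OF assms(1), of 0 i] unit_interval_partition_mono[OF assms(1), of "Suc i" m]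
    assms by (auto simp: unit_interval_partition_def)

lemma smooth_curve_has_vector_derivative:
  assumes "smooth_curve a b c" and "a < b" and "t \<in> {a..b}"
  shows "(c has_vector_derivative vector_derivative c (at t within {a..b})) (at t within {a..b})"
proof -
  obtain D where D: "\<forall>t\<in>{a..b}. D 0 t = c t \<and> (\<forall>k::nat. (D k has_vector_derivative D (Suc k) t) (at t within {a..b}))"
    using assms(1) unfolding smooth_curve_def by blast
  then have "(D 0 has_vector_derivative D (Suc 0) t) (at t within {a..b})" using assms(3) by blast
  then have "(c has_vector_derivative D (Suc 0) t) (at t within {a..b})"
    by (rule has_vector_derivative_transform[OF assms(3), rotated]) (use D in simp)
  then show ?thesis
    using vector_derivative_works differentiableI_vector by blast
qed

lemma smooth_curve_continuous: "smooth_curve a b c \<Longrightarrow> a < b \<Longrightarrow> continuous_on {a..b} c"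
  unfolding continuous_on_eq_continuous_within
  using smooth_curve_has_vector_derivative has_vector_derivative_continuous by blast

lemma smooth_curve_segment: "smooth_curve 0 1 (\<lambda>t. x + t *\<^sub>R (y - x))"
proof -
  define D where "D k t = (if k = 0 then x + t *\<^sub>R (y - x) else if k = 1 then y - x else 0)" for k :: nat and t
  have "((\<lambda>t. x + t *\<^sub>R (y - x)) has_vector_derivative y - x) (at t within {0..1})" for t
    using has_vector_derivative_add[OF has_vector_derivative_const[of x]
        has_vector_derivative_scaleR[OF DERIV_ident has_vector_derivative_const[of "y - x"]]]
    by simp
  then have "(D k has_vector_derivative D (Suc k) t) (at t within {0..1})" for k t
    by (cases k) (auto simp: D_def[abs_def])
  then show ?thesis
    unfolding smooth_curve_def by (intro exI[of _ D]) (simp add: D_def)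
qed

section \<open>The group structure of the semidirect product\<close>

context matrix_flow
begin

lemma group_semidirect: "group (semidirect_real \<phi>)"
proof (rule groupI)
  fix x assume "x \<in> carrier (semidirect_real \<phi>)"
  show "\<exists>y\<in>carrier (semidirect_real \<phi>). y \<otimes>\<^bsub>semidirect_real \<phi>\<^esub> x = \<one>\<^bsub>semidirect_real \<phi>\<^esub>"
    by (intro bexI[of _ "(- fst x, - (\<phi> (- fst x) *v snd x))"])
      (auto simp: semidirect_real_def case_prod_unfold)
qed (auto simp: semidirect_real_def case_prod_unfold matrix_vector_right_distrib)

lemma semidirect_mult [simp]:
  "x \<otimes>\<^bsub>semidirect_real \<phi>\<^esub> y = (fst x + fst y, snd x + \<phi> (fst x) *v snd y)"
  by (simp add: semidirect_real_def case_prod_unfold)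

lemma carrier_semidirect [simp]: "carrier (semidirect_real \<phi>) = UNIV"
  by (simp add: semidirect_real_def)

end

locale semidirect_holonomy = matrix_flow \<phi> A
  for \<phi> :: "real \<Rightarrow> real^'i^'i" and A +
  fixes g :: "(real \<times> (real^'i)) \<Rightarrow> (real \<times> (real^'i)) \<Rightarrow> (real \<times> (real^'i)) \<Rightarrow> real"
    and b :: "real^'i" and \<Gamma> :: "(real \<times> (real^'i)) set" and t0 :: real
  assumes levi_civita: "levi_civita g x u v = (0, - (fst u * fst v) *\<^sub>R (A *v (\<phi> (fst x) *v b)))"
    and subgroup: "subgroup \<Gamma> (semidirect_real \<phi>)"
    and fst_lattice: "fst ` \<Gamma> = range (\<lambda>k::int. t0 * of_int k)"
    and t0: "t0 \<noteq> 0"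
begin

abbreviation "G \<equiv> semidirect_real \<phi>"

section \<open>The parallel frame and the tangent spaces of the quotient\<close>

text \<open>The coordinates of a tangent vector at \<open>x\<close> in the parallel frame.\<close>

definition triv :: "real \<times> (real^'i) \<Rightarrow> real \<times> (real^'i) \<Rightarrow> real \<times> (real^'i)" where
  "triv x u = (fst u, snd u - fst u *\<^sub>R (\<phi> (fst x) *v b))"

definition untriv :: "real \<times> (real^'i) \<Rightarrow> real \<times> (real^'i) \<Rightarrow> real \<times> (real^'i)" where
  "untriv x y = (fst y, snd y + fst y *\<^sub>R (\<phi> (fst x) *v b))"

definition rot :: "real \<Rightarrow> real \<times> (real^'i) \<Rightarrow> real \<times> (real^'i)" where
  "rot r y = (fst y, \<phi> r *v snd y)"

text \<open>
  \<open>sec q \<rho> y\<close> is the tangent vector of the quotient at the orbit \<open>q\<close> whose coordinates in the parallel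
  frame are \<open>y\<close> at those points of \<open>q\<close> that have first coordinate \<open>\<rho>\<close>. For \<open>\<rho>\<close> outside \<open>fst ` q\<close> this is read
  by extending the action of \<open>\<phi>\<close> from the lattice to all real times.
\<close>

definition sec :: "(real \<times> (real^'i)) set \<Rightarrow> real \<Rightarrow> real \<times> (real^'i) \<Rightarrow> ((real \<times> (real^'i)) \<times> (real \<times> (real^'i))) set" where
  "sec q \<rho> y = (\<lambda>x. (x, untriv x (rot (fst x - \<rho>) y))) ` q"

lemma triv_untriv [simp]: "triv x (untriv x y) = y" and untriv_triv [simp]: "untriv x (triv x y) = y"
  by (simp_all add: triv_def untriv_def)

lemma rot_rot [simp]: "rot r (rot s y) = rot (r + s) y" and rot_0 [simp]: "rot 0 y = y"
  by (simp_all add: rot_def)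

text \<open>Rotating the coordinates amounts to moving the reference coordinate \<rho>. All
  comparisons between frames below are instances of this rule.\<close>

lemma sec_rot: "sec q \<rho> (rot r y) = sec q (\<rho> - r) y"
  by (simp add: sec_def algebra_simps)

lemma sec_inject:
  assumes "q \<noteq> {}" and "sec q \<rho> y = sec q \<rho> z"
  shows "y = z"
proof -
  obtain x where "x \<in> q" using assms(1) by blast
  then have "untriv x (rot (fst x - \<rho>) y) = untriv x (rot (fst x - \<rho>) z)"
    using assms(2) unfolding sec_def by blast
  then have "rot (fst x - \<rho>) y = rot (fst x - \<rho>) z" by (metis triv_untriv)
  then have "rot (\<rho> - fst x) (rot (fst x - \<rho>) y) = rot (\<rho> - fst x) (rot (fst x - \<rho>) z)" by simp
  then show ?thesis by simp
qed

lemma coset_eq: "\<Gamma> #>\<^bsub>G\<^esub> x = (\<lambda>h. (fst h + fst x, snd h + \<phi> (fst h) *v snd x)) ` \<Gamma>"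
  by (auto simp: r_coset_def)

lemma self_in_coset: "x \<in> \<Gamma> #>\<^bsub>G\<^esub> x"
  using group.rcos_self[OF group_semidirect _ subgroup] by simp

lemma coset_repr: "y \<in> \<Gamma> #>\<^bsub>G\<^esub> x \<Longrightarrow> \<Gamma> #>\<^bsub>G\<^esub> x = \<Gamma> #>\<^bsub>G\<^esub> y"
  using group.repr_independence[OF group_semidirect _ _ subgroup] by simp

lemma fst_coset: "fst ` (\<Gamma> #>\<^bsub>G\<^esub> x) = range (\<lambda>k::int. t0 * of_int k + fst x)"
proof -
  have "fst ` (\<Gamma> #>\<^bsub>G\<^esub> x) = (\<lambda>r. r + fst x) ` (fst ` \<Gamma>)"
    by (simp add: coset_eq image_image)
  then show ?thesis by (simp add: fst_lattice image_image)
qed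

text \<open>In the parallel frame a lattice element h acts by \<open>rot (fst h)\<close>, so the
  orbit of a tangent vector is the graph of one rotating coordinate vector, which is a
  \<open>sec\<close>.\<close>

lemma proj_deriv_eq: "proj_deriv G \<Gamma> x u = sec (\<Gamma> #>\<^bsub>G\<^esub> x) (fst x) (triv x u)"
proof -
  \<comment> \<open>The correction \<phi>(h + x) b added by \<open>untriv\<close> cancels the one
    subtracted by \<open>triv\<close> after rotation. The second coordinate of the point is
    arbitrary, as \<open>untriv\<close> does not read it.\<close>
  have "untriv (fst h + fst x, y) (rot (fst h) (triv x u)) = (fst u, \<phi> (fst h) *v snd u)"
    for h :: "real \<times> (real^'i)" and y
    by (simp add: untriv_def rot_def triv_def matrix_vector_mult_diff_distrib matrix_vector_mult_scaleR)
  then show ?thesis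
    unfolding proj_deriv_def left_translation_deriv_semidirect sec_def coset_eq Setcompr_eq_image
    by (simp only: image_image fst_conv semidirect_mult add_diff_cancel_right')
qed

lemma quotient_tangent_space_eq: "quotient_tangent_space G \<Gamma> (\<Gamma> #>\<^bsub>G\<^esub> x) = range (sec (\<Gamma> #>\<^bsub>G\<^esub> x) \<rho>)"
proof (intro equalityI subsetI)
  fix w assume "w \<in> quotient_tangent_space G \<Gamma> (\<Gamma> #>\<^bsub>G\<^esub> x)"
  then obtain y u where y: "y \<in> \<Gamma> #>\<^bsub>G\<^esub> x" and "w = proj_deriv G \<Gamma> y u"
    unfolding quotient_tangent_space_def by blast
  then have "w = sec (\<Gamma> #>\<^bsub>G\<^esub> x) \<rho> (rot (\<rho> - fst y) (triv y u))"
    by (simp add: proj_deriv_eq sec_rot coset_repr[OF y])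
  then show "w \<in> range (sec (\<Gamma> #>\<^bsub>G\<^esub> x) \<rho>)" by blast
next
  fix w assume "w \<in> range (sec (\<Gamma> #>\<^bsub>G\<^esub> x) \<rho>)"
  then obtain y where "w = sec (\<Gamma> #>\<^bsub>G\<^esub> x) \<rho> y" by blast
  then have "w = proj_deriv G \<Gamma> x (untriv x (rot (fst x - \<rho>) y))"
    by (simp add: proj_deriv_eq sec_rot)
  then show "w \<in> quotient_tangent_space G \<Gamma> (\<Gamma> #>\<^bsub>G\<^esub> x)"
    using self_in_coset unfolding quotient_tangent_space_def by blast
qed

text \<open>The transport equation says that \<open>fst V\<close> is constant and that the
  derivative of \<open>snd V\<close> is \<open>fst V\<close> times that of \<phi>(r) b along the
  curve. So the frame coordinates have derivative zero, and conversely \<open>untriv\<close> of a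
  constant solves it.\<close>

lemma parallel_along_iff:
  assumes c: "smooth_curve l r c" and lr: "l < r"
  shows "parallel_along g l r c V \<longleftrightarrow> (\<exists>y. \<forall>t\<in>{l..r}. triv (c t) (V t) = y)"
proof -
  define c' where "c' t = vector_derivative c (at t within {l..r})" for t
  have fst_c: "((\<lambda>t. fst (c t)) has_real_derivative fst (c' t)) (at t within {l..r})" if "t \<in> {l..r}" for t
    unfolding has_real_derivative_iff_has_vector_derivative c'_def
    by (intro bounded_linear.has_vector_derivative[OF bounded_linear_fst]
        smooth_curve_has_vector_derivative[OF c lr that])
  have flow: "((\<lambda>t. \<phi> (fst (c t)) *v b) has_vector_derivative
      fst (c' t) *\<^sub>R (A *v (\<phi> (fst (c t)) *v b))) (at t within {l..r})" if "t \<in> {l..r}" for t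
    by (rule flow_const_deriv[OF fst_c[OF that]])
  show ?thesis
  proof
    assume "parallel_along g l r c V"
    then have V: "(V has_vector_derivative (0, (fst (c' t) * fst (V t)) *\<^sub>R (A *v (\<phi> (fst (c t)) *v b)))) (at t within {l..r})"
      if "t \<in> {l..r}" for t
      using that by (simp add: parallel_along_def levi_civita c'_def)
    have fst_V: "((\<lambda>t. fst (V t)) has_vector_derivative 0) (at t within {l..r})" if "t \<in> {l..r}" for t
      using bounded_linear.has_vector_derivative[OF bounded_linear_fst V[OF that]] by simp
    have snd_V: "((\<lambda>t. snd (V t)) has_vector_derivative (fst (c' t) * fst (V t)) *\<^sub>R (A *v (\<phi> (fst (c t)) *v b))) (at t within {l..r})" if "t \<in> {l..r}" for t
      using bounded_linear.has_vector_derivative[OF bounded_linear_snd V[OF that]] by simp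
    have "((\<lambda>t. triv (c t) (V t)) has_vector_derivative 0) (at t within {l..r})" if t: "t \<in> {l..r}" for t
      unfolding triv_def
      using has_vector_derivative_Pair[OF fst_V[OF t] has_vector_derivative_diff[OF snd_V[OF t]
          has_vector_derivative_scaleR[OF fst_V[OF t, folded has_real_derivative_iff_has_vector_derivative] flow[OF t]]]]
      by (simp add: mult.commute zero_prod_def)
    then show "\<exists>y. \<forall>t\<in>{l..r}. triv (c t) (V t) = y"
      using has_derivative_zero_constant[of "{l..r}" "\<lambda>t. triv (c t) (V t)"]
      unfolding has_vector_derivative_def by simp
  next
    assume "\<exists>y. \<forall>t\<in>{l..r}. triv (c t) (V t) = y"
    then obtain y where "\<forall>t\<in>{l..r}. triv (c t) (V t) = y" by blast
    then have V: "V t = untriv (c t) y" if "t \<in> {l..r}" for t using that by (metis untriv_triv)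
    have "(V has_vector_derivative - levi_civita g (c t) (c' t) (V t)) (at t within {l..r})"
      if t: "t \<in> {l..r}" for t
    proof (rule has_vector_derivative_transform[OF t V])
      show "((\<lambda>t. untriv (c t) y) has_vector_derivative - levi_civita g (c t) (c' t) (V t)) (at t within {l..r})"
        unfolding untriv_def
        using has_vector_derivative_Pair[OF has_vector_derivative_const[of "fst y"]
            has_vector_derivative_add[OF has_vector_derivative_const[of "snd y"]
            has_vector_derivative_scaleR[OF DERIV_const[of "fst y"] flow[OF t]]]]
        by (simp add: levi_civita V[OF t] untriv_def mult.commute)
    qed
    then show "parallel_along g l r c V"
      by (simp add: parallel_along_def c'_def)
  qed
qed

section \<open>Lifts of the projected curve and parallel fields in the quotient\<close>

text \<open>\<open>\<sigma>\<close> lifts the image of the curve \<open>c\<close> in \<open>\<real>/t\<^sub>0\<int>\<close>; its total increment determines the transport along \<open>c\<close>.\<close>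

definition lifts :: "(real \<Rightarrow> (real \<times> (real^'i)) set) \<Rightarrow> (real \<Rightarrow> real) \<Rightarrow> bool" where
  "lifts c \<sigma> \<longleftrightarrow> continuous_on {0..1} \<sigma> \<and> (\<forall>t\<in>{0..1}. \<sigma> t \<in> fst ` c t)"

text \<open>At each time the two differ by an element of t0 Z, and continuity makes it constant on
  the piece. The constant may change from piece to piece, because the lifts to G need not fit
  together.\<close>

lemma lifts_piece:
  assumes "lifts c \<sigma>" and "{l..r} \<subseteq> {0..1}" and "continuous_on {l..r} c'"
    and coset: "\<And>t. t \<in> {l..r} \<Longrightarrow> c t = \<Gamma> #>\<^bsub>G\<^esub> c' t"
  shows "\<exists>s. \<forall>t\<in>{l..r}. fst (c' t) = \<sigma> t + s"
proof -
  have "continuous_on {l..r} (\<lambda>t. fst (c' t) - \<sigma> t)"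
    using assms by (auto simp: lifts_def intro!: continuous_intros elim: continuous_on_subset)
  moreover have "fst (c' t) - \<sigma> t \<in> range (\<lambda>k::int. t0 * of_int k)" if t: "t \<in> {l..r}" for t
  proof -
    have "\<sigma> t \<in> fst ` c t" using assms(1,2) t by (auto simp: lifts_def)
    then obtain k :: int where "\<sigma> t = t0 * of_int k + fst (c' t)"
      unfolding coset[OF t] fst_coset by blast
    then have "fst (c' t) - \<sigma> t = t0 * of_int (- k)" by simp
    then show ?thesis by blast
  qed
  ultimately obtain s where "\<forall>t\<in>{l..r}. fst (c' t) - \<sigma> t = s"
    using integer_multiples_continuous_constant[OF t0] by blast
  then have "\<forall>t\<in>{l..r}. fst (c' t) = \<sigma> t + s" by (simp add: algebra_simps)
  then show ?thesis by blast
qed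

text \<open>The pieces are glued by induction: each new lift is shifted in its first coordinate by
  the multiple of t0 that matches it with what has been built so far.\<close>

lemma lifts_exists:
  assumes "piecewise_smooth_curve G \<Gamma> c"
  shows "\<exists>\<sigma>. lifts c \<sigma>"
proof -
  obtain m \<tau> where \<tau>: "unit_interval_partition m \<tau>"
    and pieces: "\<And>i. i < m \<Longrightarrow> \<exists>c'. smooth_curve (\<tau> i) (\<tau> (Suc i)) c' \<and>
           (\<forall>t\<in>{\<tau> i..\<tau> (Suc i)}. c' t \<in> carrier G \<and> c t = \<Gamma> #>\<^bsub>G\<^esub> c' t)"
    using assms unfolding piecewise_smooth_curve_def by blast
  have \<tau>_less: "\<tau> i < \<tau> (Suc i)" if "i < m" for i using \<tau> that by (simp add: unit_interval_partition_def)
  have ends: "\<tau> 0 = 0" "\<tau> m = 1" "0 < m" using \<tau> by (auto simp: unit_interval_partition_def intro: Nat.gr0I)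
  have "\<exists>\<sigma>. continuous_on {0..\<tau> j} \<sigma> \<and> (\<forall>t\<in>{0..\<tau> j}. \<sigma> t \<in> fst ` c t)" if "j \<le> m" for j
    using that
  proof (induction j)
    \<comment> \<open>Here the interval is the single point 0, but a piece is still consulted to
      know that c 0 is an orbit.\<close>
    case 0
    obtain c' where "c 0 = \<Gamma> #>\<^bsub>G\<^esub> c' 0"
      using pieces[OF \<open>0 < m\<close>] ends \<tau>_less[OF \<open>0 < m\<close>] by force
    then have "fst (c' 0) \<in> fst ` c 0" using self_in_coset by simp
    then show ?case
      by (intro exI[of _ "\<lambda>_. fst (c' 0)"]) (simp add: ends)
  next
    case (Suc j)
    then obtain \<sigma> where \<sigma>: "continuous_on {0..\<tau> j} \<sigma>" "\<And>t. t \<in> {0..\<tau> j} \<Longrightarrow> \<sigma> t \<in> fst ` c t" by auto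
    have j: "j < m" using Suc.prems by simp
    obtain c' where c': "smooth_curve (\<tau> j) (\<tau> (Suc j)) c'"
      and coset: "\<And>t. t \<in> {\<tau> j..\<tau> (Suc j)} \<Longrightarrow> c t = \<Gamma> #>\<^bsub>G\<^esub> c' t"
      using pieces[OF j] by blast
    have \<tau>j: "0 \<le> \<tau> j" using unit_interval_partition_mono[OF \<tau>, of 0 j] ends j by simp
    have "\<sigma> (\<tau> j) \<in> fst ` (\<Gamma> #>\<^bsub>G\<^esub> c' (\<tau> j))"
      using \<sigma>(2)[of "\<tau> j"] coset[of "\<tau> j"] \<tau>j \<tau>_less[OF j] by simp
    then obtain k :: int where k: "\<sigma> (\<tau> j) = t0 * of_int k + fst (c' (\<tau> j))"
      unfolding fst_coset by blast
    define \<sigma>' where "\<sigma>' t = (if t \<le> \<tau> j then \<sigma> t else t0 * of_int k + fst (c' t))" for t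
    have "continuous_on ({0..\<tau> j} \<union> {\<tau> j..\<tau> (Suc j)}) \<sigma>'"
      unfolding \<sigma>'_def[abs_def]
      using \<sigma>(1) smooth_curve_continuous[OF c' \<tau>_less[OF j]] k
      by (intro continuous_on_If) (auto intro!: continuous_intros)
    moreover have "{0..\<tau> j} \<union> {\<tau> j..\<tau> (Suc j)} = {0..\<tau> (Suc j)}"
      using \<tau>j \<tau>_less[OF j] by auto
    moreover have "\<sigma>' t \<in> fst ` c t" if "t \<in> {0..\<tau> (Suc j)}" for t
    proof (cases "t \<le> \<tau> j")
      case True
      then show ?thesis using \<sigma>(2)[of t] that by (simp add: \<sigma>'_def)
    next
      case False
      then have "fst ` c t = range (\<lambda>k::int. t0 * of_int k + fst (c' t))"
        using that coset[of t] fst_coset by simp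
      then show ?thesis using False by (auto simp: \<sigma>'_def)
    qed
    ultimately show ?case by auto
  qed
  from this[of m] show ?thesis by (simp add: ends lifts_def)
qed

text \<open>On each piece the lift to G exceeds \<sigma> by a constant s, so relative to that lift
  the field has the constant coordinates \<open>rot s y\<close>.\<close>

lemma parallel_field_sec:
  assumes "piecewise_smooth_curve G \<Gamma> c" and lift: "lifts c \<sigma>"
  shows "parallel_field G \<Gamma> g c (\<lambda>t. sec (c t) (\<sigma> t) y)"
proof -
  obtain m \<tau> where \<tau>: "unit_interval_partition m \<tau>"
    and pieces: "\<And>i. i < m \<Longrightarrow> \<exists>c'. smooth_curve (\<tau> i) (\<tau> (Suc i)) c' \<and>
           (\<forall>t\<in>{\<tau> i..\<tau> (Suc i)}. c' t \<in> carrier G \<and> c t = \<Gamma> #>\<^bsub>G\<^esub> c' t)"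
    using assms unfolding piecewise_smooth_curve_def by blast
  have "\<exists>c' V. smooth_curve (\<tau> i) (\<tau> (Suc i)) c' \<and> parallel_along g (\<tau> i) (\<tau> (Suc i)) c' V \<and>
           (\<forall>t\<in>{\<tau> i..\<tau> (Suc i)}. c' t \<in> carrier G \<and> c t = \<Gamma> #>\<^bsub>G\<^esub> c' t \<and>
              sec (c t) (\<sigma> t) y = proj_deriv G \<Gamma> (c' t) (V t))" if i: "i < m" for i
  proof -
    have less: "\<tau> i < \<tau> (Suc i)" using \<tau> i by (simp add: unit_interval_partition_def)
    obtain c' where c': "smooth_curve (\<tau> i) (\<tau> (Suc i)) c'"
      and coset: "\<And>t. t \<in> {\<tau> i..\<tau> (Suc i)} \<Longrightarrow> c t = \<Gamma> #>\<^bsub>G\<^esub> c' t"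
      using pieces[OF i] by blast
    obtain s where s: "\<And>t. t \<in> {\<tau> i..\<tau> (Suc i)} \<Longrightarrow> fst (c' t) = \<sigma> t + s"
      using lifts_piece[OF lift unit_interval_partition_subset[OF \<tau> i] smooth_curve_continuous[OF c' less] coset]
      by blast
    have "parallel_along g (\<tau> i) (\<tau> (Suc i)) c' (\<lambda>t. untriv (c' t) (rot s y))"
      by (auto simp: parallel_along_iff[OF c' less])
    moreover have "sec (c t) (\<sigma> t) y = proj_deriv G \<Gamma> (c' t) (untriv (c' t) (rot s y))"
      if "t \<in> {\<tau> i..\<tau> (Suc i)}" for t
      using s[OF that] by (simp add: proj_deriv_eq coset[OF that] sec_rot)
    ultimately show ?thesis using c' coset by auto
  qed
  with \<tau> show ?thesis unfolding parallel_field_def by blast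
qed

lemma parallel_field_imp_sec:
  assumes "parallel_field G \<Gamma> g c W" and lift: "lifts c \<sigma>"
  shows "\<exists>y. W 0 = sec (c 0) (\<sigma> 0) y \<and> W 1 = sec (c 1) (\<sigma> 1) y"
proof -
  obtain m \<tau> where \<tau>: "unit_interval_partition m \<tau>"
    and pieces: "\<And>i. i < m \<Longrightarrow> \<exists>c' V. smooth_curve (\<tau> i) (\<tau> (Suc i)) c' \<and>
           parallel_along g (\<tau> i) (\<tau> (Suc i)) c' V \<and>
           (\<forall>t\<in>{\<tau> i..\<tau> (Suc i)}. c' t \<in> carrier G \<and> c t = \<Gamma> #>\<^bsub>G\<^esub> c' t \<and>
              W t = proj_deriv G \<Gamma> (c' t) (V t))"
    using assms unfolding parallel_field_def by blast
  have less: "\<tau> i < \<tau> (Suc i)" if "i < m" for i using \<tau> that by (simp add: unit_interval_partition_def)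
  have ends: "\<tau> 0 = 0" "\<tau> m = 1" "0 < m" using \<tau> by (auto simp: unit_interval_partition_def intro: Nat.gr0I)
  \<comment> \<open>Nonemptiness of the orbit is recorded since comparing coordinates at the break
    points by \<open>sec_inject\<close> requires it.\<close>
  have piece: "\<exists>y. \<forall>t\<in>{\<tau> i..\<tau> (Suc i)}. c t \<noteq> {} \<and> W t = sec (c t) (\<sigma> t) y" if i: "i < m" for i
  proof -
    obtain c' V where c': "smooth_curve (\<tau> i) (\<tau> (Suc i)) c'"
      and V: "parallel_along g (\<tau> i) (\<tau> (Suc i)) c' V"
      and coset: "\<And>t. t \<in> {\<tau> i..\<tau> (Suc i)} \<Longrightarrow> c t = \<Gamma> #>\<^bsub>G\<^esub> c' t"
      and W: "\<And>t. t \<in> {\<tau> i..\<tau> (Suc i)} \<Longrightarrow> W t = proj_deriv G \<Gamma> (c' t) (V t)"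
      using pieces[OF i] by blast
    obtain s where s: "\<And>t. t \<in> {\<tau> i..\<tau> (Suc i)} \<Longrightarrow> fst (c' t) = \<sigma> t + s"
      using lifts_piece[OF lift unit_interval_partition_subset[OF \<tau> i] smooth_curve_continuous[OF c' less[OF i]] coset]
      by blast
    obtain y where y: "\<And>t. t \<in> {\<tau> i..\<tau> (Suc i)} \<Longrightarrow> triv (c' t) (V t) = y"
      using V unfolding parallel_along_iff[OF c' less[OF i]] by blast
    have "c t \<noteq> {} \<and> W t = sec (c t) (\<sigma> t) (rot (- s) y)" if "t \<in> {\<tau> i..\<tau> (Suc i)}" for t
      using self_in_coset[of "c' t"] by (auto simp: W[OF that] proj_deriv_eq coset[OF that] y[OF that] sec_rot s[OF that])
    then show ?thesis by blast
  qed
  \<comment> \<open>Adjacent pieces share a break point, where injectivity of \<open>sec\<close>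
    forces their coordinate vectors to agree. The index j names the last piece covered, so the end
    point 1 is reached at j = m - 1.\<close>
  have "\<exists>y. W 0 = sec (c 0) (\<sigma> 0) y \<and> W (\<tau> (Suc j)) = sec (c (\<tau> (Suc j))) (\<sigma> (\<tau> (Suc j))) y" if "j < m" for j
    using that
  proof (induction j)
    case 0
    then show ?case using piece[of 0] less[of 0] ends by force
  next
    case (Suc j)
    obtain y where y: "W 0 = sec (c 0) (\<sigma> 0) y"
        "W (\<tau> (Suc j)) = sec (c (\<tau> (Suc j))) (\<sigma> (\<tau> (Suc j))) y"
      using Suc.IH Suc.prems by auto
    obtain z where z: "\<And>t. t \<in> {\<tau> (Suc j)..\<tau> (Suc (Suc j))} \<Longrightarrow> c t \<noteq> {} \<and> W t = sec (c t) (\<sigma> t) z"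
      using piece[OF Suc.prems] by blast
    have "y = z"
      using z[of "\<tau> (Suc j)"] y(2) less[OF Suc.prems]
      by (intro sec_inject[of "c (\<tau> (Suc j))" "\<sigma> (\<tau> (Suc j))"]) auto
    with y(1) z[of "\<tau> (Suc (Suc j))"] less[OF Suc.prems] show ?case
      by (intro exI[of _ z]) simp
  qed
  from this[of "m - 1"] show ?thesis by (simp add: ends)
qed

section \<open>Transport maps and the holonomy group\<close>

definition transport :: "(real \<times> (real^'i)) set \<Rightarrow> real \<Rightarrow>
    ((real \<times> (real^'i)) \<times> (real \<times> (real^'i))) set \<Rightarrow> ((real \<times> (real^'i)) \<times> (real \<times> (real^'i))) set" where
  "transport q r = (\<lambda>w\<in>range (sec q 0). sec q 0 (rot r (inv_into UNIV (sec q 0) w)))"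

text \<open>Rotations commute, so the reference coordinate 0 in the definition may be replaced by
  any \<rho>; the map depends on r and the orbit alone.\<close>

lemma transport_sec: "q \<noteq> {} \<Longrightarrow> transport q r (sec q \<rho> y) = sec q \<rho> (rot r y)"
proof -
  assume "q \<noteq> {}"
  then have "inj (sec q 0)" by (auto intro: injI sec_inject)
  moreover have "sec q \<rho> y = sec q 0 (rot (- \<rho>) y)" for y by (simp add: sec_rot)
  ultimately show ?thesis by (simp add: transport_def add.commute)
qed

text \<open>A parallel field is \<open>sec (c t) (\<sigma> t) y\<close> with y fixed. Rewriting its
  end value relative to \<sigma> 0 instead of \<sigma> 1 produces the rotation by \<sigma> 0 -
  \<sigma> 1.\<close>

lemma parallel_transport_eq:
  assumes "piecewise_smooth_curve G \<Gamma> c" and lift: "lifts c \<sigma>" and c0: "c 0 = \<Gamma> #>\<^bsub>G\<^esub> x" and c1: "c 1 = c 0"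
  shows "parallel_transport G \<Gamma> g c = transport (\<Gamma> #>\<^bsub>G\<^esub> x) (\<sigma> 0 - \<sigma> 1)"
proof -
  have nonempty: "c 0 \<noteq> {}" using self_in_coset[of x] by (auto simp: c0)
  have "(THE z. \<exists>W. parallel_field G \<Gamma> g c W \<and> W 0 = sec (c 0) 0 y \<and> W 1 = z) =
      transport (c 0) (\<sigma> 0 - \<sigma> 1) (sec (c 0) 0 y)" for y
  proof (rule the_equality)
    show "\<exists>W. parallel_field G \<Gamma> g c W \<and> W 0 = sec (c 0) 0 y \<and>
        W 1 = transport (c 0) (\<sigma> 0 - \<sigma> 1) (sec (c 0) 0 y)"
      \<comment> \<open>Coordinates y relative to 0 become \<open>rot (\<sigma> 0) y\<close>
        relative to \<sigma> 0.\<close>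
      using parallel_field_sec[OF assms(1) lift, of "rot (\<sigma> 0) y"]
      by (intro exI[of _ "\<lambda>t. sec (c t) (\<sigma> t) (rot (\<sigma> 0) y)"])
        (simp add: sec_rot transport_sec[OF nonempty] c1)
  next
    fix z assume "\<exists>W. parallel_field G \<Gamma> g c W \<and> W 0 = sec (c 0) 0 y \<and> W 1 = z"
    then obtain W where W: "parallel_field G \<Gamma> g c W" "W 0 = sec (c 0) 0 y" "W 1 = z" by blast
    obtain y' where y': "W 0 = sec (c 0) (\<sigma> 0) y'" "W 1 = sec (c 1) (\<sigma> 1) y'"
      using parallel_field_imp_sec[OF W(1) lift] by blast
    have "sec (c 0) (\<sigma> 0) y' = sec (c 0) (\<sigma> 0) (rot (\<sigma> 0) y)"
      using W(2) y'(1) by (simp add: sec_rot)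
    then have "y' = rot (\<sigma> 0) y" by (rule sec_inject[OF nonempty])
    then show "z = transport (c 0) (\<sigma> 0 - \<sigma> 1) (sec (c 0) 0 y)"
      using W(3) y'(2) by (simp add: transport_sec[OF nonempty] c1 sec_rot)
  qed
  then show ?thesis
    unfolding parallel_transport_def c0 quotient_tangent_space_eq[where \<rho> = 0]
    by (auto simp: transport_def c0 restrict_def fun_eq_iff)
qed

lemma holonomy_carrier:
  "carrier (holonomy_group G \<Gamma> g (\<Gamma> #>\<^bsub>G\<^esub> x)) = range (\<lambda>k::int. transport (\<Gamma> #>\<^bsub>G\<^esub> x) (t0 * of_int k))"
proof (intro equalityI subsetI)
  fix T assume "T \<in> carrier (holonomy_group G \<Gamma> g (\<Gamma> #>\<^bsub>G\<^esub> x))"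
  then obtain c where c: "piecewise_smooth_curve G \<Gamma> c" "c 0 = \<Gamma> #>\<^bsub>G\<^esub> x" "c 1 = \<Gamma> #>\<^bsub>G\<^esub> x"
    and T: "T = parallel_transport G \<Gamma> g c"
    by (auto simp: holonomy_group_def)
  obtain \<sigma> where \<sigma>: "lifts c \<sigma>" using lifts_exists[OF c(1)] by blast
  then have "\<forall>t\<in>{0..1}. \<sigma> t \<in> fst ` c t" by (simp add: lifts_def)
  from bspec[OF this, of 0] bspec[OF this, of 1]
  have "\<sigma> 0 \<in> fst ` (\<Gamma> #>\<^bsub>G\<^esub> x)" "\<sigma> 1 \<in> fst ` (\<Gamma> #>\<^bsub>G\<^esub> x)"
    by (simp_all add: c)
  then obtain j k :: int where "\<sigma> 0 = t0 * of_int j + fst x" "\<sigma> 1 = t0 * of_int k + fst x"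
    unfolding fst_coset by blast
  then have "\<sigma> 0 - \<sigma> 1 = t0 * of_int (j - k)" by (simp add: right_diff_distrib)
  then have "T = transport (\<Gamma> #>\<^bsub>G\<^esub> x) (t0 * of_int (j - k))"
    using parallel_transport_eq[OF c(1) \<sigma> c(2)] c T by simp
  then show "T \<in> range (\<lambda>k::int. transport (\<Gamma> #>\<^bsub>G\<^esub> x) (t0 * of_int k))" by blast
next
  fix T assume "T \<in> range (\<lambda>k::int. transport (\<Gamma> #>\<^bsub>G\<^esub> x) (t0 * of_int k))"
  then obtain k :: int where T: "T = transport (\<Gamma> #>\<^bsub>G\<^esub> x) (t0 * of_int k)" by blast
  \<comment> \<open>A loop that raises \<sigma> by r transports by -r, so the end point must lie -k
    t0 away. The segment from x to such a point of its orbit projects to a loop at the base point,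
    with one piece and the partition \<open>real\<close> with values 0 and 1.\<close>
  have "t0 * of_int (- k) + fst x \<in> fst ` (\<Gamma> #>\<^bsub>G\<^esub> x)" unfolding fst_coset by blast
  then obtain y where y: "y \<in> \<Gamma> #>\<^bsub>G\<^esub> x" "fst y = t0 * of_int (- k) + fst x" by force
  define c' where "c' t = x + t *\<^sub>R (y - x)" for t
  define c where "c t = \<Gamma> #>\<^bsub>G\<^esub> c' t" for t
  have "smooth_curve 0 1 c'"
    unfolding c'_def[abs_def] by (rule smooth_curve_segment)
  then have "piecewise_smooth_curve G \<Gamma> c"
    unfolding piecewise_smooth_curve_def
    by (intro exI[of _ "1::nat"] exI[of _ real] conjI allI impI exI[of _ c'])
      (auto simp: unit_interval_partition_def c_def)
  moreover have c: "c 0 = \<Gamma> #>\<^bsub>G\<^esub> x" "c 1 = \<Gamma> #>\<^bsub>G\<^esub> x"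
    using coset_repr[OF y(1)] by (simp_all add: c_def c'_def)
  moreover have "lifts c (\<lambda>t. fst (c' t))"
    unfolding lifts_def c_def
    by (intro conjI ballI imageI self_in_coset) (auto simp: c'_def intro!: continuous_intros)
  ultimately have "parallel_transport G \<Gamma> g c = T"
    by (simp add: parallel_transport_eq T c'_def y(2))
  with \<open>piecewise_smooth_curve G \<Gamma> c\<close> c show "T \<in> carrier (holonomy_group G \<Gamma> g (\<Gamma> #>\<^bsub>G\<^esub> x))"
    by (auto simp: holonomy_group_def)
qed

lemma transport_Bij:
  assumes "q \<noteq> {}"
  shows "transport q r \<in> Bij (range (sec q 0))"
proof -
  have "bij_betw (transport q r) (range (sec q 0)) (range (sec q 0))"
    by (rule bij_betw_byWitness[where f' = "transport q (- r)"]) (auto simp: transport_sec[OF assms])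
  then show ?thesis by (simp add: Bij_def transport_def)
qed

lemma holonomy_mult:
  "transport (\<Gamma> #>\<^bsub>G\<^esub> x) r \<otimes>\<^bsub>holonomy_group G \<Gamma> g (\<Gamma> #>\<^bsub>G\<^esub> x)\<^esub> transport (\<Gamma> #>\<^bsub>G\<^esub> x) s = transport (\<Gamma> #>\<^bsub>G\<^esub> x) (r + s)"
proof -
  have q: "\<Gamma> #>\<^bsub>G\<^esub> x \<noteq> {}" using self_in_coset by blast
  have "compose (range (sec q 0)) (transport q r) (transport q s) = transport q (r + s)" if "q \<noteq> {}" for q
  proof
    fix w
    show "compose (range (sec q 0)) (transport q r) (transport q s) w = transport q (r + s) w"
    proof (cases "w \<in> range (sec q 0)")
      case True
      then obtain y where "w = sec q 0 y" by blast
      then show ?thesis by (simp add: compose_def transport_sec[OF that])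
    next
      case False
      then show ?thesis unfolding compose_def transport_def by (simp only: restrict_apply if_False)
    qed
  qed
  with q show ?thesis
    by (simp add: holonomy_group_def BijGroup_def quotient_tangent_space_eq[where \<rho> = 0] transport_Bij)
qed

lemma transport_eq_iff:
  assumes "q \<noteq> {}"
  shows "transport q r = transport q s \<longleftrightarrow> \<phi> (r - s) = mat 1"
proof
  assume "transport q r = transport q s"
  then have "sec q 0 (rot r y) = sec q 0 (rot s y)" for y
    by (metis transport_sec[OF assms])
  then have "rot r y = rot s y" for y by (rule sec_inject[OF assms])
  then have "\<phi> r *v v = \<phi> s *v v" for v
    by (metis rot_def snd_conv)
  then have "\<phi> (- s) *v (\<phi> r *v v) = mat 1 *v v" for v by simp
  then show "\<phi> (r - s) = mat 1" by (simp add: matrix_eq)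
next
  assume *: "\<phi> (r - s) = mat 1"
  have "rot r y = rot s y" for y
    using rot_rot[of s "r - s" y] by (simp add: rot_def *)
  then show "transport q r = transport q s" by (simp add: transport_def)
qed

text \<open>Transport by k t0 is additive in k, it exhausts the holonomy group, and it is trivial
  exactly for multiples of d.\<close>

lemma holonomy_iso_integer_mod_group:
  assumes "d > 0" and d: "\<And>k::int. \<phi> (t0 * of_int k) = mat 1 \<longleftrightarrow> int d dvd k"
  shows "holonomy_group G \<Gamma> g (\<Gamma> #>\<^bsub>G\<^esub> x) \<cong> integer_mod_group d"
proof -
  define q where "q = \<Gamma> #>\<^bsub>G\<^esub> x"
  have q: "q \<noteq> {}" using self_in_coset unfolding q_def by blast
  define f where "f k = transport q (t0 * of_int k)" for k :: int
  have f_eq: "f j = f k \<longleftrightarrow> j mod int d = k mod int d" for j k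
    unfolding f_def transport_eq_iff[OF q]
    by (simp add: d mod_eq_dvd_iff flip: right_diff_distrib of_int_diff)
  have "f \<in> hom (integer_mod_group d) (holonomy_group G \<Gamma> g q)"
  proof (rule homI)
    fix j k
    have "f j \<otimes>\<^bsub>holonomy_group G \<Gamma> g q\<^esub> f k = f (j + k)"
      by (simp add: f_def q_def holonomy_mult distrib_left)
    also have "\<dots> = f (j \<otimes>\<^bsub>integer_mod_group d\<^esub> k)" by (simp add: f_eq)
    finally show "f (j \<otimes>\<^bsub>integer_mod_group d\<^esub> k) = f j \<otimes>\<^bsub>holonomy_group G \<Gamma> g q\<^esub> f k" ..
  qed (simp add: holonomy_carrier q_def f_def)
  moreover have "bij_betw f (carrier (integer_mod_group d)) (carrier (holonomy_group G \<Gamma> g q))"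
    unfolding bij_betw_def
  proof
    show "inj_on f (carrier (integer_mod_group d))"
      using \<open>d > 0\<close> by (auto simp: inj_on_def f_eq carrier_integer_mod_group)
    have "f k \<in> f ` {0..<int d}" for k
      using \<open>d > 0\<close> by (intro image_eqI[of _ _ "k mod int d"]) (auto simp: f_eq)
    then show "f ` carrier (integer_mod_group d) = carrier (holonomy_group G \<Gamma> g q)"
      using \<open>d > 0\<close> by (auto simp: holonomy_carrier q_def f_def carrier_integer_mod_group)
  qed
  ultimately have "integer_mod_group d \<cong> holonomy_group G \<Gamma> g q"
    by (auto simp: is_iso_def iso_def)
  then show ?thesis
    unfolding q_def by (rule group.iso_sym[OF group_integer_mod_group])
qed

end

section \<open>Rotation matrices and the lattice\<close>

lemma has_vector_derivative_vecI:
  fixes f :: "real \<Rightarrow> 'b::euclidean_space ^ 'n"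
  assumes "\<And>i. ((\<lambda>t. f t $ i) has_vector_derivative f' $ i) (at x within T)"
  shows "(f has_vector_derivative f') (at x within T)"
proof -
  have "((\<lambda>t. f t \<bullet> axis i u) has_derivative (\<lambda>t. (t *\<^sub>R f') \<bullet> axis i u)) (at x within T)" for i u
    using bounded_linear.has_derivative[OF bounded_linear_inner_left assms[of i, unfolded has_vector_derivative_def], of u]
    by (simp add: inner_axis)
  then show ?thesis
    unfolding has_vector_derivative_def has_derivative_componentwise_within[of f] Basis_vec_def
    by auto
qed

text \<open>The blocks are encoded by coordinates: \<open>\<pi>\<close> gives the partner within a
  block, \<open>\<omega>\<close> the frequency and \<open>\<epsilon>\<close> the sign of the sine. A
  row then has at most two nonzero entries, and frequency 0 covers the identity part.\<close>

definition block_rotation :: "('i \<Rightarrow> real) \<Rightarrow> ('i \<Rightarrow> real) \<Rightarrow> ('i \<Rightarrow> 'i) \<Rightarrow> real \<Rightarrow> real^'i^'i::finite" where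
  "block_rotation \<omega> \<epsilon> \<pi> t = (\<chi> i j. if j = i then cos (\<omega> i * t) else if j = \<pi> i then \<epsilon> i * sin (\<omega> i * t) else 0)"

definition block_generator :: "('i \<Rightarrow> real) \<Rightarrow> ('i \<Rightarrow> real) \<Rightarrow> ('i \<Rightarrow> 'i) \<Rightarrow> real^'i^'i::finite" where
  "block_generator \<omega> \<epsilon> \<pi> = (\<chi> i j. if j = \<pi> i then \<epsilon> i * \<omega> i else 0)"

text \<open>The coordinates \<open>i\<close> and \<open>\<pi> i\<close> span a rotation block; fixed coordinates have \<open>\<pi> i = i\<close> and \<open>\<omega> i = 0\<close>.\<close>

locale rotation_blocks =
  fixes \<omega> \<epsilon> :: "'i::finite \<Rightarrow> real" and \<pi> :: "'i \<Rightarrow> 'i"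
  assumes pi_pi [simp]: "\<pi> (\<pi> i) = i" and omega_pi [simp]: "\<omega> (\<pi> i) = \<omega> i"
    and eps: "\<epsilon> i * \<epsilon> i = 1"
    and moved: "\<omega> i \<noteq> 0 \<Longrightarrow> \<pi> i \<noteq> i \<and> \<epsilon> (\<pi> i) = - \<epsilon> i"
begin

abbreviation "R \<equiv> block_rotation \<omega> \<epsilon> \<pi>"
abbreviation "N \<equiv> block_generator \<omega> \<epsilon> \<pi>"

lemma rotation_component: "(R t *v x) $ i = cos (\<omega> i * t) * x $ i + \<epsilon> i * sin (\<omega> i * t) * x $ \<pi> i"
proof -
  have "(R t *v x) $ i = (\<Sum>j\<in>UNIV. (if j = i then cos (\<omega> i * t) * x $ i else 0) +
      (if j = \<pi> i then \<epsilon> i * sin (\<omega> i * t) * x $ \<pi> i else 0))"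
    \<comment> \<open>The two conditions overlap only if \<open>\<pi> i = i\<close>; then
      \<open>\<omega> i = 0\<close> and the sine term vanishes, so the sum may be split.\<close>
    unfolding matrix_vector_mult_def using moved[of i]
    by (cases "\<omega> i = 0") (auto simp: block_rotation_def intro!: sum.cong)
  then show ?thesis by (simp add: sum.distrib)
qed

lemma generator_rotation: "(N ** R t) $ i $ j = \<epsilon> i * \<omega> i * R t $ \<pi> i $ j"
  by (simp add: matrix_matrix_mult_def block_generator_def if_distrib[of "\<lambda>x. x * _"] cong: if_cong)

lemma matrix_flow: "matrix_flow R N"
proof
  show "R 0 = mat 1"
    by (simp add: block_rotation_def mat_def vec_eq_iff)
  show "R (r + t) = R r ** R t" for r t
  proof -
    have "R (r + t) *v x = (R r ** R t) *v x" for x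
    proof (simp only: vec_eq_iff matrix_vector_mul_assoc[symmetric], intro allI)
      fix i
      show "(R (r + t) *v x) $ i = (R r *v (R t *v x)) $ i"
        using eps[of i] moved[of i]
        by (cases "\<omega> i = 0") (simp_all add: rotation_component cos_add sin_add algebra_simps)
    qed
    then show ?thesis by (simp add: matrix_eq)
  qed
  show "(R has_vector_derivative N ** R t) (at t)" for t
  proof (intro has_vector_derivative_vecI)
    fix i j
    show "((\<lambda>t. R t $ i $ j) has_vector_derivative (N ** R t) $ i $ j) (at t)"
      unfolding generator_rotation has_real_derivative_iff_has_vector_derivative[symmetric]
      using moved[of i] eps[of i]
      by (cases "\<omega> i = 0"; cases "j = i"; cases "j = \<pi> i")
        (auto simp: block_rotation_def intro!: derivative_eq_intros)
  qed
qed

lemma rotation_eq_one_iff: "R t = mat 1 \<longleftrightarrow> (\<forall>i. cos (\<omega> i * t) = 1)"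
  by (auto simp: block_rotation_def mat_def vec_eq_iff cos_one_sin_zero)

lemma rotation_bounded: "\<bar>R t $ i $ j\<bar> \<le> 1"
proof -
  have "\<bar>\<epsilon> i\<bar> = 1" using eps[of i] by (simp add: power2_eq_square flip: abs_square_eq_1)
  then show ?thesis by (simp add: block_rotation_def abs_mult)
qed

end

section \<open>Integer conjugates, finite order and the lattice as a subgroup\<close>

lemma matrix_inv_mult:
  assumes "invertible P"
  shows "P ** matrix_inv P = mat 1" and "matrix_inv P ** P = mat 1"
  using someI_ex[OF assms[unfolded invertible_def]] by (simp_all add: matrix_inv_def)

lemma integer_matrix_mult: "integer_matrix M \<Longrightarrow> integer_matrix N \<Longrightarrow> integer_matrix (M ** N)"
  for M :: "real^'n^'m" and N :: "real^'k^'n"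
  by (auto simp: integer_matrix_def matrix_matrix_mult_def intro!: Ints_sum Ints_mult)

lemma finite_bounded_integer_matrices:
  "finite {M :: real^'n^'m. integer_matrix M \<and> (\<forall>i j. \<bar>M $ i $ j\<bar> \<le> K)}"
proof -
  define Z where "Z = {x \<in> \<int>. \<bar>x\<bar> \<le> K}"
  have "finite Z" unfolding Z_def by (rule finite_abs_int_segment)
  have "{M :: real^'n^'m. integer_matrix M \<and> (\<forall>i j. \<bar>M $ i $ j\<bar> \<le> K)} \<subseteq>
      (\<lambda>f. \<chi> i j. f (i, j)) ` PiE UNIV (\<lambda>_. Z)"
    by (auto simp: integer_matrix_def Z_def vec_eq_iff intro!: image_eqI[where x = "\<lambda>(i, j). _ $ i $ j"])
  then show ?thesis
    by (rule finite_subset) (auto intro!: finite_imageI finite_PiE \<open>finite Z\<close>)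
qed

text \<open>The conjugates \<open>Q k\<close> of the powers are integer matrices with entries
  bounded independently of k. Only finitely many such matrices exist, so two powers coincide and
  their quotient is the identity.\<close>

lemma (in matrix_flow) finite_order_of_integer_conjugate:
  assumes P: "invertible P" and int: "integer_matrix (matrix_inv P ** \<phi> r ** P)"
    and bounded: "\<And>t i j. \<bar>\<phi> t $ i $ j\<bar> \<le> 1"
  shows "\<exists>m>0. \<phi> (r * real m) = mat 1"
    and "integer_matrix (matrix_inv P ** \<phi> (r * real k) ** P)"
proof -
  define Q where "Q k = matrix_inv P ** \<phi> (r * real k) ** P" for k
  have PP: "P ** matrix_inv P = mat 1" "matrix_inv P ** P = mat 1"
    using P by (simp_all add: matrix_inv_mult)
  have "Q (Suc k) = Q k ** Q 1" for k
  proof -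
    have "Q k ** Q 1 = matrix_inv P ** \<phi> (r * real k) ** (P ** matrix_inv P) ** \<phi> r ** P"
      by (simp add: Q_def matrix_mul_assoc)
    also have "\<dots> = matrix_inv P ** (\<phi> (r * real k) ** \<phi> r) ** P"
      by (simp add: PP matrix_mul_assoc)
    finally show ?thesis by (simp add: Q_def algebra_simps flip: flow_add)
  qed
  moreover have "integer_matrix (Q 0)"
  proof -
    have "Q 0 = mat 1" by (simp add: Q_def PP)
    then show ?thesis by (simp add: integer_matrix_def mat_def)
  qed
  ultimately have Q_int: "integer_matrix (Q k)" for k
    using int by (induction k) (auto intro: integer_matrix_mult simp: Q_def)
  then show "integer_matrix (matrix_inv P ** \<phi> (r * real k) ** P)" by (simp add: Q_def)
  \<comment> \<open>Summing over all four indices gives one bound for every entry and every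
    k.\<close>
  define K where "K = (\<Sum>i\<in>UNIV. \<Sum>l\<in>UNIV. \<Sum>m\<in>UNIV. \<Sum>j\<in>UNIV. \<bar>matrix_inv P $ i $ l\<bar> * \<bar>P $ m $ j\<bar>)"
  have "\<bar>Q k $ i $ j\<bar> \<le> K" for k i j
  proof -
    have "Q k $ i $ j = (\<Sum>m\<in>UNIV. (\<Sum>l\<in>UNIV. matrix_inv P $ i $ l * \<phi> (r * real k) $ l $ m) * P $ m $ j)"
      by (simp add: Q_def matrix_matrix_mult_def)
    also have "\<bar>\<dots>\<bar> \<le> (\<Sum>m\<in>UNIV. \<Sum>l\<in>UNIV. \<bar>matrix_inv P $ i $ l * \<phi> (r * real k) $ l $ m * P $ m $ j\<bar>)"
      by (auto simp: sum_distrib_right intro!: order_trans[OF sum_abs] sum_mono)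
    also have "\<dots> \<le> (\<Sum>m\<in>UNIV. \<Sum>l\<in>UNIV. \<bar>matrix_inv P $ i $ l\<bar> * \<bar>P $ m $ j\<bar>)"
    proof (intro sum_mono)
      fix m l
      have "\<bar>matrix_inv P $ i $ l\<bar> * \<bar>\<phi> (r * real k) $ l $ m\<bar> * \<bar>P $ m $ j\<bar> \<le> \<bar>matrix_inv P $ i $ l\<bar> * 1 * \<bar>P $ m $ j\<bar>"
        by (intro mult_right_mono mult_left_mono bounded) auto
      then show "\<bar>matrix_inv P $ i $ l * \<phi> (r * real k) $ l $ m * P $ m $ j\<bar> \<le> \<bar>matrix_inv P $ i $ l\<bar> * \<bar>P $ m $ j\<bar>"
        by (simp add: abs_mult)
    qed
    also have "\<dots> = (\<Sum>l\<in>UNIV. \<Sum>m\<in>UNIV. \<bar>matrix_inv P $ i $ l\<bar> * \<bar>P $ m $ j\<bar>)"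
      by (rule sum.swap)
    also have "\<dots> \<le> (\<Sum>l\<in>UNIV. \<Sum>m\<in>UNIV. \<Sum>j\<in>UNIV. \<bar>matrix_inv P $ i $ l\<bar> * \<bar>P $ m $ j\<bar>)"
      by (intro sum_mono member_le_sum) auto
    also have "\<dots> \<le> K"
      unfolding K_def by (rule member_le_sum) (auto intro!: sum_nonneg)
    finally show ?thesis .
  qed
  then have "range Q \<subseteq> {M. integer_matrix M \<and> (\<forall>i j. \<bar>M $ i $ j\<bar> \<le> K)}"
    using Q_int by auto
  then have "finite (range Q)"
    using finite_bounded_integer_matrices finite_subset by blast
  then have "\<not> inj Q"
    using finite_imageD infinite_UNIV_nat by blast
  then obtain j k where "Q j = Q k" "j < k"
    unfolding inj_def by (metis linorder_neqE_nat)
  then have "P ** Q j ** matrix_inv P = P ** Q k ** matrix_inv P" by simp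
  moreover have "P ** Q k ** matrix_inv P = \<phi> (r * real k)" for k
  proof -
    have "P ** Q k ** matrix_inv P = (P ** matrix_inv P) ** \<phi> (r * real k) ** (P ** matrix_inv P)"
      by (simp add: Q_def matrix_mul_assoc)
    then show ?thesis by (simp add: PP)
  qed
  ultimately have "\<phi> (- (r * real j)) ** \<phi> (r * real j) = \<phi> (- (r * real j)) ** \<phi> (r * real k)"
    by simp
  then have "\<phi> (r * real (k - j)) = mat 1"
    using \<open>j < k\<close> by (simp add: of_nat_diff right_diff_distrib flip: flow_add)
  with \<open>j < k\<close> show "\<exists>m>0. \<phi> (r * real m) = mat 1"
    by (intro exI[of _ "k - j"]) simp
qed

lemma (in matrix_flow) inv_semidirect: "inv\<^bsub>semidirect_real \<phi>\<^esub> x = (- fst x, - (\<phi> (- fst x) *v snd x))"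
  by (rule group.inv_equality[OF group_semidirect]) (simp_all, simp add: semidirect_real_def)

lemma integer_matrix_vector_mult:
  "integer_matrix M \<Longrightarrow> (\<And>i. z $ i \<in> \<int>) \<Longrightarrow> (M *v z) $ i \<in> \<int>"
  for M :: "real^'n^'m"
  by (auto simp: integer_matrix_def matrix_vector_mult_def intro!: Ints_sum Ints_mult)

text \<open>Conjugated by P, each \<phi>(k t0) preserves the integer vectors. Inverses call for
  negative k, hence the hypothesis for all integers.\<close>

lemma (in matrix_flow) subgroup_semidirect_lattice:
  assumes P: "invertible P" and int: "\<And>k::int. integer_matrix (matrix_inv P ** \<phi> (t0 * of_int k) ** P)"
  shows "subgroup (semidirect_lattice t0 P) (semidirect_real \<phi>)"
proof -
  have shift: "\<exists>z'. (\<forall>i. z' $ i \<in> \<int>) \<and> \<phi> (t0 * of_int k) *v (P *v z) = P *v z'"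
    if z: "\<forall>i. z $ i \<in> \<int>" for k :: int and z
  proof (intro exI conjI allI)
    show "((matrix_inv P ** \<phi> (t0 * of_int k) ** P) *v z) $ i \<in> \<int>" for i
      using z by (intro integer_matrix_vector_mult int) auto
    have "P ** (matrix_inv P ** \<phi> (t0 * of_int k) ** P) = (P ** matrix_inv P) ** \<phi> (t0 * of_int k) ** P"
      by (simp add: matrix_mul_assoc)
    then show "\<phi> (t0 * of_int k) *v (P *v z) = P *v ((matrix_inv P ** \<phi> (t0 * of_int k) ** P) *v z)"
      using P by (simp add: matrix_vector_mul_assoc matrix_inv_mult)
  qed
  show ?thesis
  proof (rule group.subgroupI[OF group_semidirect])
    have "(t0 * of_int 0, P *v 0) \<in> semidirect_lattice t0 P"
      unfolding semidirect_lattice_def by (intro CollectI exI[of _ 0] exI[of _ "0 :: real^'i"]) simp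
    then show "semidirect_lattice t0 P \<noteq> {}" by blast
  next
    fix x assume "x \<in> semidirect_lattice t0 P"
    then obtain k z where x: "x = (t0 * of_int k, P *v z)" and z: "\<forall>i. z $ i \<in> \<int>"
      by (auto simp: semidirect_lattice_def)
    obtain z' where z': "\<forall>i. z' $ i \<in> \<int>" "\<phi> (t0 * of_int (- k)) *v (P *v z) = P *v z'"
      using shift[OF z] by blast
    have "inv\<^bsub>semidirect_real \<phi>\<^esub> x = (t0 * of_int (- k), P *v (- z'))"
      using z'(2) by (simp add: inv_semidirect x)
    moreover have "\<forall>i. (- z') $ i \<in> \<int>" using z'(1) by simp
    ultimately show "inv\<^bsub>semidirect_real \<phi>\<^esub> x \<in> semidirect_lattice t0 P"
      unfolding semidirect_lattice_def by blast
  next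
    fix x y assume "x \<in> semidirect_lattice t0 P" "y \<in> semidirect_lattice t0 P"
    then obtain k z j w where x: "x = (t0 * of_int k, P *v z)" and z: "\<forall>i. z $ i \<in> \<int>"
      and y: "y = (t0 * of_int j, P *v w)" and w: "\<forall>i. w $ i \<in> \<int>"
      by (auto simp: semidirect_lattice_def)
    obtain w' where w': "\<forall>i. w' $ i \<in> \<int>" "\<phi> (t0 * of_int k) *v (P *v w) = P *v w'"
      using shift[OF w] by blast
    have "x \<otimes>\<^bsub>semidirect_real \<phi>\<^esub> y = (t0 * of_int (k + j), P *v (z + w'))"
      using w'(2) by (simp add: x y distrib_left matrix_vector_right_distrib)
    moreover have "\<forall>i. (z + w') $ i \<in> \<int>" using z w'(1) by simp
    ultimately show "x \<otimes>\<^bsub>semidirect_real \<phi>\<^esub> y \<in> semidirect_lattice t0 P"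
      unfolding semidirect_lattice_def by blast
  qed simp
qed

lemma fst_semidirect_lattice: "fst ` semidirect_lattice t0 P = range (\<lambda>k::int. t0 * of_int k)"
proof -
  have "(t0 * of_int k, P *v 0) \<in> semidirect_lattice t0 P" for k
    unfolding semidirect_lattice_def by (intro CollectI exI[of _ k] exI[of _ 0]) simp
  then have "t0 * of_int k \<in> fst ` semidirect_lattice t0 P" for k
    by (metis fst_conv image_eqI)
  then show ?thesis by (auto simp: semidirect_lattice_def)
qed

section \<open>Orders of the rotation blocks\<close>

lemma group_general_linear: "group (general_linear_group :: (real^'n^'n) monoid)"
proof (rule groupI)
  fix M :: "real^'n^'n" assume "M \<in> carrier general_linear_group"
  then show "\<exists>N\<in>carrier general_linear_group. N \<otimes>\<^bsub>general_linear_group\<^esub> M = \<one>\<^bsub>general_linear_group\<^esub>"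
    by (auto simp: general_linear_group_def invertible_def)
next
  have "invertible (mat 1 :: real^'n^'n)" by (auto simp: invertible_def)
  then show "\<one>\<^bsub>general_linear_group\<^esub> \<in> carrier (general_linear_group :: (real^'n^'n) monoid)"
    by (simp add: general_linear_group_def)
qed (auto simp: general_linear_group_def invertible_mult matrix_mul_assoc)

lemma theta_add: "theta (r + t) = theta r ** theta t"
  by (simp add: theta_def matrix_matrix_mult_def vec_eq_iff forall_2 sum_2 vector_2 cos_add sin_add algebra_simps)

lemma theta_eq_one_iff: "theta t = mat 1 \<longleftrightarrow> cos t = 1"
  by (auto simp: theta_def mat_def vec_eq_iff forall_2 vector_2 cos_one_sin_zero)

text \<open>A rotation of infinite order has \<open>ord\<close> equal to 0, and 0 divides only k =
  0, so that case is covered as well.\<close>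

lemma ord_theta_dvd_iff: "group.ord general_linear_group (theta t) dvd k \<longleftrightarrow> cos (t * real k) = 1"
proof -
  have pow: "theta t [^]\<^bsub>general_linear_group\<^esub> k = theta (t * real k)" for k :: nat
    by (induction k)
      (simp_all add: general_linear_group_def theta_eq_one_iff[THEN iffD2] algebra_simps flip: theta_add)
  have "theta t ** theta (- t) = mat 1" "theta (- t) ** theta t = mat 1"
    by (simp_all add: theta_eq_one_iff flip: theta_add)
  then have "theta t \<in> carrier general_linear_group"
    by (auto simp: general_linear_group_def invertible_def)
  from group.pow_eq_id[OF group_general_linear this, of k] show ?thesis
    by (simp add: pow theta_eq_one_iff flip: theta_eq_one_iff) (simp add: general_linear_group_def theta_eq_one_iff)
qed

lemma integer_mod_group_1_iso: "integer_mod_group 1 \<cong> singleton_group (0 :: int)"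
proof -
  have "carrier (integer_mod_group 1) = {0}"
    by (auto simp: carrier_integer_mod_group)
  then have "(\<lambda>x. x) \<in> iso (integer_mod_group 1) (singleton_group 0)"
    by (auto simp: iso_def hom_def singleton_group_def)
  then show ?thesis by (auto simp: is_iso_def)
qed

text \<open>The bridge from the numbered coordinates to \<open>rotation_blocks\<close>: index
  arithmetic is confined to this proof.\<close>

lemma almost_abelian_action_blocks:
  fixes num :: "'i::finite \<Rightarrow> nat"
  assumes num: "bij_betw num UNIV {..<s + 2 * n}"
  obtains \<omega> \<epsilon> \<pi> where "rotation_blocks \<omega> \<epsilon> \<pi>" and "almost_abelian_action num s a = block_rotation \<omega> \<epsilon> \<pi>"
    and "\<And>t. (\<forall>i. cos (\<omega> i * t) = 1) \<longleftrightarrow> (\<forall>j\<in>{1..n}. cos (a j * t) = 1)"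
proof -
  have inj: "num i = num j \<longleftrightarrow> i = j" for i j
    using num by (auto simp: bij_betw_def inj_def)
  have surj: "\<exists>i. num i = p" if "p < s + 2 * n" for p
    using num that unfolding bij_betw_def by (metis imageE lessThan_iff)
  have less: "num i < s + 2 * n" for i
    using num by (auto simp: bij_betw_def)
  \<comment> \<open>Past the first s numbers, \<open>partner\<close> exchanges s + 2q with s + 2q +
    1, the two positions of one block.\<close>
  define partner where "partner p = (if p < s then p else if even (p - s) then p + 1 else p - 1)" for p
  have partner_less: "partner p < s + 2 * n" if "p < s + 2 * n" for p
    using that unfolding partner_def by presburger
  define \<pi> where "\<pi> i = inv_into UNIV num (partner (num i))" for i
  have num_pi: "num (\<pi> i) = partner (num i)" for i
    unfolding \<pi>_def using surj[OF partner_less[OF less]] by (metis f_inv_into_f rangeI)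
  define \<omega> where "\<omega> i = (if num i < s then 0 else a ((num i - s) div 2 + 1))" for i
  \<comment> \<open>In \<open>theta\<close> the sine has sign + in the first row, at even offset,
    and sign - in the second.\<close>
  define \<epsilon> :: "'i \<Rightarrow> real" where "\<epsilon> i = (if even (num i - s) then 1 else - 1)" for i
  have partner_add: "partner (s + r) = s + (if even r then r + 1 else r - 1)" for r
    by (cases "even r") (auto simp: partner_def elim!: oddE)
  have partner_block: "\<not> p < s \<Longrightarrow> \<not> partner p < s \<and> (partner p - s) div 2 = (p - s) div 2 \<and>
      even (partner p - s) = odd (p - s) \<and> partner p \<noteq> p \<and> partner (partner p) = p" for p
  proof -
    assume "\<not> p < s"
    then obtain r where r: "p = s + r" using le_Suc_ex not_less by blast
    have "\<not> s + q < s" "s + q - s = q" for q by simp_all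
    moreover obtain q where "q = (if even r then r + 1 else r - 1)" "q div 2 = r div 2" "even q = odd r"
      "q \<noteq> r" "(if even q then q + 1 else q - 1) = r"
      by (cases "even r") (auto elim!: evenE oddE)
    ultimately show ?thesis
      unfolding r by (simp only: partner_add) simp
  qed
  have partner_partner: "partner (partner p) = p" for p
    using partner_block[of p] by (cases "p < s") (simp_all add: partner_def[of p])
  have "rotation_blocks \<omega> \<epsilon> \<pi>"
  proof
    fix i
    show "\<pi> (\<pi> i) = i" using partner_partner[of "num i"] by (simp add: num_pi flip: inj)
    have "partner (num i) = num i" if "num i < s" using that by (simp add: partner_def)
    then show "\<omega> (\<pi> i) = \<omega> i" using partner_block[of "num i"] by (auto simp: \<omega>_def num_pi)
    show "\<epsilon> i * \<epsilon> i = 1" by (simp add: \<epsilon>_def)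
    show "\<pi> i \<noteq> i \<and> \<epsilon> (\<pi> i) = - \<epsilon> i" if "\<omega> i \<noteq> 0"
      using that partner_block[of "num i"] by (auto simp: \<omega>_def \<epsilon>_def num_pi simp flip: inj split: if_splits)
  qed
  moreover have "almost_abelian_action num s a = block_rotation \<omega> \<epsilon> \<pi>"
  proof (intro ext, simp only: vec_eq_iff, intro allI)
    fix t i j
    have same: "(num j - s) div 2 = (num i - s) div 2 \<longleftrightarrow> j = i \<or> j = \<pi> i" if "\<not> num i < s" "\<not> num j < s"
    proof -
      have "q div 2 = p div 2 \<longleftrightarrow> q = p \<or> q = (if even p then p + 1 else p - 1)" for p q :: nat
      proof (cases "even p")
        case True
        then obtain k where "p = 2 * k" by (elim evenE)
        then show ?thesis by auto
      next
        case False
        then obtain k where "p = 2 * k + 1" by (elim oddE)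
        then show ?thesis by auto
      qed
      then have "(num j - s) div 2 = (num i - s) div 2 \<longleftrightarrow>
          num j - s = num i - s \<or> num j - s = (if even (num i - s) then num i - s + 1 else num i - s - 1)"
        by blast
      moreover have "num j - s = r \<longleftrightarrow> num j = s + r" for r using that by auto
      moreover have "s + (num i - s) = num i" using that by simp
      ultimately have "(num j - s) div 2 = (num i - s) div 2 \<longleftrightarrow> num j = num i \<or> num j = partner (num i)"
        using partner_add[of "num i - s"] by simp
      then show ?thesis by (simp add: inj flip: num_pi)
    qed
    have "num i < s \<Longrightarrow> \<pi> i = i" by (simp add: num_pi partner_def flip: inj)
    moreover have "\<pi> i \<noteq> i \<and> (even (num (\<pi> i) - s) \<longleftrightarrow> odd (num i - s)) \<and> \<not> num (\<pi> i) < s" if "\<not> num i < s"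
      using partner_block[OF that] unfolding num_pi[symmetric] by (metis inj)
    moreover have "num (\<pi> i) = num i" if "\<pi> i = i" using that by simp
    ultimately show "almost_abelian_action num s a t $ i $ j = block_rotation \<omega> \<epsilon> \<pi> t $ i $ j"
      using same
      by (cases "num i < s"; cases "num j < s"; cases "j = i"; cases "j = \<pi> i")
        (simp_all add: almost_abelian_action_def block_rotation_def Let_def theta_def vector_2 \<omega>_def \<epsilon>_def inj)
  qed
  moreover have "(\<forall>i. cos (\<omega> i * t) = 1) \<longleftrightarrow> (\<forall>j\<in>{1..n}. cos (a j * t) = 1)" for t
  proof (intro iffI ballI allI)
    fix j assume *: "\<forall>i. cos (\<omega> i * t) = 1" and j: "j \<in> {1..n}"
    \<comment> \<open>Blocks are counted from 1, so the j-th one starts at number s + 2(j -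
      1).\<close>
    have "s + 2 * (j - 1) < s + 2 * n" using j unfolding atLeastAtMost_iff by linarith
    from surj[OF this] obtain i where "num i = s + 2 * (j - 1)" by blast
    then have "\<omega> i = a j" using j by (simp add: \<omega>_def)
    with *[rule_format, of i] show "cos (a j * t) = 1" by simp
  next
    fix i assume *: "\<forall>j\<in>{1..n}. cos (a j * t) = 1"
    show "cos (\<omega> i * t) = 1"
    proof (cases "num i < s")
      case False
      then have "(num i - s) div 2 + 1 \<in> {1..n}" using less[of i] unfolding atLeastAtMost_iff by arith
      from bspec[OF * this] False show ?thesis by (simp add: \<omega>_def)
    qed (simp add: \<omega>_def)
  qed
  ultimately show ?thesis by (rule that)
qed

section \<open>The holonomy group of the lattice quotient\<close>

theorem theorem3p7:
  fixes s n d :: nat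
    and num :: "'i::finite \<Rightarrow> nat"
    and a :: "nat \<Rightarrow> real"
    and t0 :: real
    and P :: "real^'i^'i"
    and \<phi> :: "real \<Rightarrow> real^'i^'i"
    and G :: "(real \<times> (real^'i)) monoid"
    and g :: "(real \<times> (real^'i)) \<Rightarrow> (real \<times> (real^'i)) \<Rightarrow> (real \<times> (real^'i)) \<Rightarrow> real"
    and \<Gamma> p :: "(real \<times> (real^'i)) set"
  assumes "n \<ge> 1"
    and "bij_betw num UNIV {..<s + 2 * n}"
    and "\<forall>i j. 1 \<le> i \<and> i \<le> j \<and> j \<le> n \<longrightarrow> a i \<ge> a j"
    and "\<forall>i\<in>{1..n}. a i > 0"
    and "\<phi> = almost_abelian_action num s a"
    and "G = semidirect_real \<phi>"
    and "riemannian_metric g" and "left_invariant G g" and "flat_metric g"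
    and "t0 \<noteq> 0"
    and "invertible P" and "integer_matrix (matrix_inv P ** \<phi> t0 ** P)"
    and "\<Gamma> = semidirect_lattice t0 P"
    and "d = (LCM i\<in>{1..n}. group.ord general_linear_group (theta (a i * t0)))"
    and "p \<in> rcosets\<^bsub>G\<^esub> \<Gamma>"
  shows "holonomy_group G \<Gamma> g p \<cong> (if d > 1 then integer_mod_group d else singleton_group 0)"
proof -
  obtain \<omega> \<epsilon> \<pi> where blocks: "rotation_blocks \<omega> \<epsilon> \<pi>" and \<phi>: "\<phi> = block_rotation \<omega> \<epsilon> \<pi>"
    and cos_iff: "\<And>t. (\<forall>i. cos (\<omega> i * t) = 1) \<longleftrightarrow> (\<forall>j\<in>{1..n}. cos (a j * t) = 1)"
    using almost_abelian_action_blocks[OF assms(2)] assms(5) by metis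
  interpret rotation_blocks \<omega> \<epsilon> \<pi> by (rule blocks)
  define A where "A = block_generator \<omega> \<epsilon> \<pi>"
  interpret matrix_flow \<phi> A
    unfolding \<phi> A_def by (rule matrix_flow)
  interpret left_invariant_metric \<phi> A g
    by unfold_locales (use assms in simp_all)
  \<comment> \<open>The matrix is the identity iff every block is, that is iff every block order
    divides k, which is divisibility by their least common multiple.\<close>
  have d_nat: "\<phi> (t0 * real k) = mat 1 \<longleftrightarrow> d dvd k" for k
    unfolding \<phi> rotation_eq_one_iff cos_iff assms(14)
    by (simp add: Lcm_dvd_iff ord_theta_dvd_iff mult.assoc)
  have d_int: "\<phi> (t0 * of_int k) = mat 1 \<longleftrightarrow> int d dvd k" for k :: int
  proof -
    have "cos (x * (t0 * of_int k)) = cos (x * (t0 * real (nat \<bar>k\<bar>)))" for x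
      by (cases "k \<ge> 0") simp_all
    then have "\<phi> (t0 * of_int k) = mat 1 \<longleftrightarrow> \<phi> (t0 * real (nat \<bar>k\<bar>)) = mat 1"
      unfolding \<phi> rotation_eq_one_iff by simp
    then show ?thesis unfolding d_nat by (simp add: int_dvd_int_iff[symmetric])
  qed
  have bounded: "\<bar>\<phi> t $ i $ j\<bar> \<le> 1" for t i j
    unfolding \<phi> by (rule rotation_bounded)
  note order = finite_order_of_integer_conjugate[OF assms(11,12) bounded]
  \<comment> \<open>Some positive power of \<phi>(t0) is the identity, so d divides a positive
    number. This excludes the default value 0 that a block of infinite order would give.\<close>
  have "d > 0" using order(1) d_nat by (auto intro!: Nat.gr0I)
  have "integer_matrix (matrix_inv P ** \<phi> (t0 * of_int k) ** P)" for k :: int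
  proof -
    \<comment> \<open>Reducing k modulo the period d brings negative exponents back to the natural
      powers already known to be conjugate to integer matrices.\<close>
    have "k = int d * (k div int d) + k mod int d" by simp
    then have "\<phi> (t0 * of_int k) = \<phi> (t0 * of_int (int d * (k div int d)) + t0 * of_int (k mod int d))"
      by (metis distrib_left of_int_add)
    also have "\<dots> = \<phi> (t0 * real (nat (k mod int d)))"
      using d_int[of "int d * (k div int d)"] \<open>d > 0\<close> by (simp add: flow_add)
    finally show ?thesis using order(2) by simp
  qed
  then have \<Gamma>: "subgroup \<Gamma> (semidirect_real \<phi>)"
    unfolding assms(13) by (rule subgroup_semidirect_lattice[OF assms(11)])
  interpret semidirect_holonomy \<phi> A g b \<Gamma> t0
    by (intro semidirect_holonomy.intro semidirect_holonomy_axioms.intro matrix_flow_axioms \<Gamma> assms(10)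
        flat_levi_civita[OF assms(9)] fst_semidirect_lattice[of t0 P, folded assms(13)])
  obtain x where p: "p = \<Gamma> #>\<^bsub>G\<^esub> x"
    using assms(15) by (auto simp: RCOSETS_def)
  have iso: "holonomy_group G \<Gamma> g p \<cong> integer_mod_group d"
    unfolding p assms(6) by (rule holonomy_iso_integer_mod_group[OF \<open>d > 0\<close> d_int])
  show ?thesis
  proof (cases "d > 1")
    case False
    with \<open>d > 0\<close> have "d = 1" by simp
    with iso iso_trans[OF _ integer_mod_group_1_iso] show ?thesis by simp
  qed (use iso in simp)
qed

end
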